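(* Let $F$ be a graph with $\chi(F)=r+1\ge3$. For every real $p>1$ and every $\varepsilon>0$ there exist $\delta>0$ and $n_0$ such that if $G$ is a graph on $n\ge n_0$ vertices containing no subgraph isomorphic to $F$ and $\lambda^{(p)}(G)\ge\left(1-\frac1r-\delta\right)n^{2-2/p}$, then the edit distance satisfies $d(G,T_r(n))\le\varepsilon n^2$.
   Context: For a graph $G$ on vertex set $\{1,\dots,n\}$ and real $p\ge1$, the $p$-spectral radius is $\lambda^{(p)}(G)=\max\{2\sum_{\{i,j\}\in E(G)}x_ix_j:\ x\in\mathbb R^n,\ |x_1|^p+\dots+|x_n|^p=1\}$. $T_r(n)$ is the complete $r$-partite graph on $n$ vertices with part sizes as equal as possible. For two graphs $G_1,G_2$ on the same $n$-vertex set (up to identification of vertex sets), the edit distance $d(G_1,G_2)$ is the minimum number of edge additions and deletions needed to turn $G_1$ into a graph isomorphic to $G_2$. *)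

theory Defs
  imports Complex_Main
begin

definition simple_graph :: "nat \<Rightarrow> nat set set \<Rightarrow> bool" where
  "simple_graph n E \<longleftrightarrow> (\<forall>e\<in>E. \<exists>i j. i < n \<and> j < n \<and> i \<noteq> j \<and> e = {i, j})"

definition colorable :: "nat \<Rightarrow> nat set set \<Rightarrow> nat \<Rightarrow> bool" where
  "colorable n E k \<longleftrightarrow>
     (\<exists>c :: nat \<Rightarrow> nat. (\<forall>i<n. c i < k) \<and> (\<forall>i j. {i, j} \<in> E \<longrightarrow> c i \<noteq> c j))"

definition chromatic_number :: "nat \<Rightarrow> nat set set \<Rightarrow> nat" where
  "chromatic_number n E = (LEAST k. colorable n E k)"

definition contains_subgraph :: "nat \<Rightarrow> nat set set \<Rightarrow> nat \<Rightarrow> nat set set \<Rightarrow> bool" where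
  "contains_subgraph n EG m EF \<longleftrightarrow>
     (\<exists>f :: nat \<Rightarrow> nat. inj_on f {..<m} \<and> f ` {..<m} \<subseteq> {..<n} \<and>
        (\<forall>i j. {i, j} \<in> EF \<longrightarrow> {f i, f j} \<in> EG))"

definition p_spectral_radius :: "nat \<Rightarrow> nat set set \<Rightarrow> real \<Rightarrow> real" where
  "p_spectral_radius n E p =
     Sup {2 * (\<Sum>e\<in>E. \<Prod>v\<in>e. x v) | x :: nat \<Rightarrow> real. (\<Sum>i<n. \<bar>x i\<bar> powr p) = 1}"

text \<open>Turan graph T_r(n): vertex i lies in part (i mod r); parts have sizes differing by at most 1.\<close>
definition turan_graph :: "nat \<Rightarrow> nat \<Rightarrow> nat set set" where
  "turan_graph n r = {{i, j} | i j. i < n \<and> j < n \<and> i mod r \<noteq> j mod r}"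

definition edit_distance :: "nat \<Rightarrow> nat set set \<Rightarrow> nat set set \<Rightarrow> nat" where
  "edit_distance n E1 E2 =
     (LEAST k. \<exists>\<sigma>. bij_betw \<sigma> {..<n} {..<n} \<and>
        k = card ((E1 - (\<lambda>e. \<sigma> ` e) ` E2) \<union> ((\<lambda>e. \<sigma> ` e) ` E2 - E1)))"

end

theory Submission
  imports Defs "HOL-Analysis.Convex"
begin

text \<open>
  Let \<open>w\<close> be a vertex weighting of total mass at most 1 with all weights tiny.  A weighted
  Erdos--Stone theorem says that total edge weight at least \<open>(1 - 1/r) w(V)\<^sup>2 + c\<close> forces a complete
  \<open>(r+1)\<close>-partite subgraph with large parts, hence a copy of \<open>F\<close>.  Let \<open>b \<ge> 0\<close> be a nearly optimal
  vector for the spectral radius, scaled to \<open>\<Sum> b\<^sub>u\<^sup>p = n\<close>.  Its large entries are negligible because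
  \<open>p > 1\<close>, and for the others the weights \<open>b\<^sub>u\<^sup>p / n\<close> are tiny, so
  \<open>\<Sum> (b\<^sub>u b\<^sub>v)\<^sup>p \<le> (1 - 1/r + c) n\<^sup>2\<close> over ordered edges; with \<open>z \<le> z\<^sup>p/p + 1 - 1/p\<close> this turns the spectral
  hypothesis into \<open>2 e(G) \<ge> (1 - 1/r - \<delta>') n\<^sup>2\<close>.

  For such dense \<open>G\<close>, pass to a subgraph of large minimum degree containing a complete \<open>r\<close>-partite
  graph with big parts.  Almost every vertex misses most of exactly one part and sees almost
  everything in the others, which gives \<open>r\<close> classes; a class with many edges would
  contain a large complete bipartite graph, extendable to a complete \<open>(r+1)\<close>-partite one.  Counting
  edges then shows that the classes are nearly balanced and almost completely joined.
\<close>

subsection \<open>Complete multipartite subgraphs under a minimum degree condition\<close>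

text \<open>Disjointness of the parts is left implicit: when \<open>A\<close> is irreflexive, a
  vertex lying in two parts would be adjacent to itself. The size is only a lower bound, so a family
  for a large \<open>t\<close> serves for smaller ones.\<close>

definition multipartite :: "('a \<Rightarrow> 'a \<Rightarrow> bool) \<Rightarrow> 'a set \<Rightarrow> nat \<Rightarrow> nat \<Rightarrow> (nat \<Rightarrow> 'a set) \<Rightarrow> bool" where
  "multipartite A V k t P \<longleftrightarrow> (\<forall>i<k. P i \<subseteq> V \<and> t \<le> card (P i)) \<and>
     (\<forall>i<k. \<forall>j<k. i \<noteq> j \<longrightarrow> (\<forall>u\<in>P i. \<forall>v\<in>P j. A u v))"

definition deg :: "('a \<Rightarrow> real) \<Rightarrow> ('a \<Rightarrow> 'a \<Rightarrow> bool) \<Rightarrow> 'a set \<Rightarrow> 'a \<Rightarrow> real" where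
  "deg w A S v = (\<Sum>u\<in>{u\<in>S. A v u}. w u)"

text \<open>Ordered pairs are summed, so each edge counts twice. The complete graph thus has weight
  close to \<open>(sum w S)^2\<close>, and the Turan threshold is the factor \<open>1 - 1/r\<close>
  without a further half.\<close>

definition edge_weight :: "('a \<Rightarrow> real) \<Rightarrow> ('a \<Rightarrow> 'a \<Rightarrow> bool) \<Rightarrow> 'a set \<Rightarrow> real" where
  "edge_weight w A S = (\<Sum>v\<in>S. w v * deg w A S v)"

text \<open>Common neighbours in a weak sense: such a vertex needs only \<open>t\<close> neighbours
  in each part, which is what a new part of a blow-up requires.\<close>

definition common_neighbours :: "('a \<Rightarrow> 'a \<Rightarrow> bool) \<Rightarrow> 'a set \<Rightarrow> (nat \<Rightarrow> 'a set) \<Rightarrow> nat \<Rightarrow> nat \<Rightarrow> 'a set" where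
  "common_neighbours A S P k t = {v\<in>S. \<forall>i<k. t \<le> card {u\<in>P i. A v u}}"

lemma multipartite_trim:
  assumes "multipartite A V k t P"
  obtains Q where "multipartite A V k t Q" "\<And>i. i < k \<Longrightarrow> card (Q i) = t"
proof -
  have "\<exists>R. R \<subseteq> P i \<and> card R = t" if "i < k" for i
    using assms that obtain_subset_with_card_n[of t "P i"] unfolding multipartite_def by metis
  then obtain Q where Q: "\<And>i. i < k \<Longrightarrow> Q i \<subseteq> P i \<and> card (Q i) = t" by metis
  have "multipartite A V k t Q"
    unfolding multipartite_def
  proof (intro conjI allI impI ballI)
    fix i assume "i < k"
    then show "Q i \<subseteq> V" "t \<le> card (Q i)" using Q[of i] assms unfolding multipartite_def by auto
  next
    fix i j u v assume "i < k" "j < k" "i \<noteq> j" "u \<in> Q i" "v \<in> Q j"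
    then show "A u v" using Q[of i] Q[of j] assms unfolding multipartite_def by blast
  qed
  then show thesis using that Q by blast
qed

lemma multipartite_mono:
  assumes "multipartite A V k t P" "V \<subseteq> V'" "t' \<le> t"
  shows "multipartite A V' k t' P"
  using assms unfolding multipartite_def by (meson order_trans)

lemma large_fibre:
  assumes "finite X" "f ` X \<subseteq> Y" "finite Y" "card Y \<le> N" "t * N < card X"
  obtains y where "y \<in> f ` X" "t \<le> card {x\<in>X. f x = y}"
proof (rule ccontr)
  assume *: "\<not> thesis"
  have "card X = (\<Sum>y\<in>f ` X. card {x\<in>X. f x = y})"
    using sum.image_gen[OF assms(1), of "\<lambda>_. 1::nat" f] by simp
  also have "\<dots> \<le> (\<Sum>y\<in>f ` X. t)"
    by (rule sum_mono) (use * that in \<open>meson nat_le_linear\<close>)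
  also have "\<dots> \<le> t * N"
    using card_mono[OF assms(3,2)] assms(4) by simp
  finally show False using assms(5) by simp
qed

lemma card_Union_parts_le:
  assumes "\<And>i. i < k \<Longrightarrow> card (P i) = T"
  shows "card (\<Union>i<k. P i) \<le> k * T"
  using card_UN_le[of "{..<k}" P] assms by simp

text \<open>The traces of vertices on the union of the parts number at most
  \<open>2 ^ (k * T)\<close>. If more than \<open>t\<close> times as many vertices were common
  neighbours, \<open>t\<close> of them would share one trace \<open>y\<close>; they form a new part,
  and each old part shrinks to \<open>P i \<inter> y\<close>.\<close>

lemma card_common_neighbours_le:
  assumes "finite V" "symp A" "multipartite A V k T P" "\<And>i. i < k \<Longrightarrow> card (P i) = T"
    and no: "\<nexists>Q. multipartite A V (Suc k) t Q"
  shows "card (common_neighbours A V P k t) \<le> t * 2 ^ (k * T)"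
proof (rule ccontr)
  let ?X = "common_neighbours A V P k t"
  let ?U = "\<Union>i<k. P i"
  let ?f = "\<lambda>v. {u\<in>?U. A v u}"
  assume "\<not> ?thesis"
  then have large: "t * 2 ^ (k * T) < card ?X" by simp
  have PV: "P i \<subseteq> V" if "i < k" for i using assms(3) that unfolding multipartite_def by blast
  have finU: "finite ?U" using assms(1) PV by (meson UN_least finite_subset lessThan_iff)
  have finX: "finite ?X" using assms(1) unfolding common_neighbours_def by simp
  have "card (Pow ?U) \<le> 2 ^ (k * T)"
    using card_Union_parts_le[of k P T] assms(4) finU by (simp add: card_Pow)
  then obtain y where y: "y \<in> ?f ` ?X" "t \<le> card {x\<in>?X. ?f x = y}"
    using large_fibre[OF finX, of ?f "Pow ?U" "2 ^ (k * T)" t] finU large by blast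
  define Q where "Q = (\<lambda>i. if i < k then P i \<inter> y else {x\<in>?X. ?f x = y})"
  have yA: "A x u" if "x \<in> ?X" "?f x = y" "u \<in> y" for x u using that by blast
  have "multipartite A V (Suc k) t Q"
    unfolding multipartite_def
  proof (intro conjI allI impI ballI)
    fix i assume i: "i < Suc k"
    show "Q i \<subseteq> V" using PV[of i] by (auto simp: Q_def common_neighbours_def)
    show "t \<le> card (Q i)"
    proof (cases "i < k")
      case True
      from y(1) obtain x where x: "x \<in> ?X" "y = ?f x" by blast
      then have "P i \<inter> y = {u\<in>P i. A x u}" using True by auto
      then show ?thesis using x True by (simp add: Q_def common_neighbours_def)
    next
      case False
      then have "Q i = {x\<in>?X. ?f x = y}" unfolding Q_def by (rule if_not_P)
      with y(2) show ?thesis by (simp only:)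
    qed
  next
    fix i j u v assume ij: "i < Suc k" "j < Suc k" "i \<noteq> j" "u \<in> Q i" "v \<in> Q j"
    consider "i < k" "j < k" | "i = k" "j < k" | "i < k" "j = k" using ij by linarith
    then show "A u v"
    proof cases
      case 1
      then show ?thesis using assms(3) ij unfolding multipartite_def Q_def by auto
    next
      case 2
      then have "u \<in> ?X" "?f u = y" "v \<in> y" using ij(4,5) by (simp_all add: Q_def)
      then show ?thesis by (rule yA)
    next
      case 3
      then have "v \<in> ?X" "?f v = y" "u \<in> y" using ij(4,5) by (simp_all add: Q_def)
      then have "A v u" by (rule yA)
      then show ?thesis by (rule sympD[OF assms(2)])
    qed
  qed
  then show False using no by blast
qed

lemma neighbours_in_parts_le:
  assumes "\<And>i. i < k \<Longrightarrow> finite (P i)" "\<And>i. i < k \<Longrightarrow> card (P i) = T"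
  shows "(\<Sum>i<k. card {u\<in>P i. A v u}) \<le> k * T"
proof -
  have "(\<Sum>i<k. card {u\<in>P i. A v u}) \<le> (\<Sum>i<k. T)"
    by (rule sum_mono) (metis (no_types, lifting) assms card_mono lessThan_iff mem_Collect_eq subsetI)
  then show ?thesis by simp
qed

text \<open>One part contributes fewer than \<open>t\<close>, every other part at most its size
  \<open>T\<close>. This deficit of nearly a whole part drives the double counts below.\<close>

lemma neighbours_in_parts_not_common:
  assumes "\<And>i. i < k \<Longrightarrow> finite (P i)" "\<And>i. i < k \<Longrightarrow> card (P i) = T"
    and "v \<in> S" "v \<notin> common_neighbours A S P k t"
  obtains i where "i < k" "card {u\<in>P i. A v u} < t"
    "(\<Sum>i<k. card {u\<in>P i. A v u}) \<le> (k - 1) * T + t"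
proof -
  obtain i where i: "i < k" "card {u\<in>P i. A v u} < t"
    using assms(3,4) unfolding common_neighbours_def by auto
  have "(\<Sum>j\<in>{..<k}-{i}. card {u\<in>P j. A v u}) \<le> (\<Sum>j\<in>{..<k}-{i}. T)"
    by (rule sum_mono) (metis (no_types, lifting) assms(1,2) card_mono DiffD1 lessThan_iff mem_Collect_eq subsetI)
  also have "\<dots> = (k - 1) * T" using i by simp
  finally have "(\<Sum>i<k. card {u\<in>P i. A v u}) \<le> (k - 1) * T + t"
    using i by (simp add: sum.remove[of "{..<k}" i])
  with i that show thesis by blast
qed

lemma sum_deg_parts:
  assumes "finite S" "symp A" "\<And>i. i < k \<Longrightarrow> finite (P i)"
  shows "(\<Sum>i<k. \<Sum>u\<in>P i. deg w A S u) = (\<Sum>v\<in>S. w v * real (\<Sum>i<k. card {u\<in>P i. A v u}))"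
proof -
  have sym: "A u v \<longleftrightarrow> A v u" for u v using assms(2) by (meson sympD)
  have "(\<Sum>i<k. \<Sum>u\<in>P i. deg w A S u) = (\<Sum>i<k. \<Sum>u\<in>P i. \<Sum>v\<in>S. if A v u then w v else 0)"
    unfolding deg_def using assms(1) sym by (simp add: sum.inter_filter)
  also have "\<dots> = (\<Sum>v\<in>S. \<Sum>i<k. \<Sum>u\<in>P i. if A v u then w v else 0)"
    by (subst sum.swap[of _ S]) (simp add: sum.swap[of _ _ S])
  also have "\<dots> = (\<Sum>v\<in>S. \<Sum>i<k. w v * real (card {u\<in>P i. A v u}))"
    using assms(3) by (intro sum.cong refl) (simp add: sum.If_cases Int_def mult.commute)
  finally show ?thesis by (simp add: sum_distrib_left)
qed

lemma deg_le:
  assumes "finite S" "\<And>v. v \<in> S \<Longrightarrow> 0 \<le> w v"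
  shows "deg w A S v \<le> sum w S"
  unfolding deg_def by (rule sum_mono2) (use assms in auto)

text \<open>Induction on \<open>r\<close>. Blow up to \<open>r\<close> parts of a large size
  \<open>T\<close>, then double count the weighted edges between these parts and \<open>S\<close>:
  the degrees are too large for almost all weight to lie outside the common neighbours, so an
  \<open>(r+1)\<close>-st part exists. The degree condition is multiplied by \<open>r\<close> so
  that it makes sense at \<open>r = 0\<close>.\<close>

lemma min_degree_blowup:
  fixes c :: real
  assumes "c > 0"
  shows "\<exists>\<eta>>0. \<forall>A (S :: 'a set) w. symp A \<longrightarrow> finite S \<longrightarrow> 0 < sum w S \<longrightarrow>
     (\<forall>v\<in>S. 0 \<le> w v \<and> w v \<le> \<eta> * sum w S) \<longrightarrow>
     (\<forall>v\<in>S. (real r - 1 + c) * sum w S \<le> real r * deg w A S v) \<longrightarrow>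
     (\<exists>P. multipartite A S (Suc r) t P)"
proof (induction r arbitrary: t)
  case 0
  show ?case
  proof (intro exI[of _ "1 / (real t + 1)"] conjI allI impI)
    fix A :: "'a \<Rightarrow> 'a \<Rightarrow> bool" and S :: "'a set" and w
    assume S: "finite S" "0 < sum w S" "\<forall>v\<in>S. 0 \<le> w v \<and> w v \<le> 1 / (real t + 1) * sum w S"
    \<comment> \<open>Weights of at most a \<open>1 / (t + 1)\<close> fraction of the total force at
      least \<open>t + 1\<close> vertices, and a single part is just a large set.\<close>
    have "sum w S \<le> (\<Sum>v\<in>S. 1 / (real t + 1) * sum w S)"
      by (rule sum_mono) (use S in auto)
    then have "sum w S * (real t + 1) \<le> sum w S * real (card S)" by (simp add: field_simps)
    then have "real t + 1 \<le> real (card S)" by (rule mult_left_le_imp_le[OF _ S(2)])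
    then show "\<exists>P. multipartite A S (Suc 0) t P"
      by (intro exI[of _ "\<lambda>_. S"]) (auto simp: multipartite_def)
  qed auto
next
  case (Suc r)
  define k where "k = Suc r"
  \<comment> \<open>\<open>T\<close> makes the surplus \<open>c * T / 2\<close> exceed
    \<open>t\<close>, the neighbours that an ordinary vertex may have in its worst part.\<close>
  define T where "T = nat \<lceil>(2 * real t + 1) / c\<rceil>"
  have "(2 * real t + 1) / c \<le> real T" unfolding T_def by (rule real_nat_ceiling_ge)
  then have cT: "2 * real t + 1 \<le> c * real T" using assms by (simp add: field_simps)
  obtain \<eta>1 where \<eta>1: "\<eta>1 > 0" and IH: "\<And>A (S :: 'a set) w. symp A \<Longrightarrow> finite S \<Longrightarrow> 0 < sum w S \<Longrightarrow>
     (\<forall>v\<in>S. 0 \<le> w v \<and> w v \<le> \<eta>1 * sum w S) \<Longrightarrow>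
     (\<forall>v\<in>S. (real r - 1 + c) * sum w S \<le> real r * deg w A S v) \<Longrightarrow>
     (\<exists>P. multipartite A S (Suc r) T P)"
    using Suc.IH[of T] by blast
  define M where "M = t * 2 ^ (k * T)"
  \<comment> \<open>There are at most \<open>M\<close> common neighbours, so their weight is at most
    \<open>M * \<eta> * W\<close>; this \<open>\<eta>\<close> lets them consume only half of the
    surplus \<open>c\<close>.\<close>
  define \<eta> where "\<eta> = min \<eta>1 (c / (2 * (real M * real k + 1)))"
  have den: "0 < real M * real k + 1" by (smt (verit) mult_nonneg_nonneg of_nat_0_le_iff)
  have \<eta>: "\<eta> > 0" "\<eta> \<le> \<eta>1" using \<eta>1 assms den by (auto simp: \<eta>_def)
  have M\<eta>: "real M * \<eta> * real k \<le> c / 2"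
  proof -
    have "real M * real k * \<eta> \<le> (real M * real k + 1) * (c / (2 * (real M * real k + 1)))"
      by (rule mult_mono) (use \<eta> in \<open>auto simp: \<eta>_def\<close>)
    also have "\<dots> = c / 2" using den by (simp add: field_simps)
    finally show ?thesis by (simp add: mult_ac)
  qed
  show ?case
  proof (intro exI[of _ \<eta>] conjI allI impI)
    fix A :: "'a \<Rightarrow> 'a \<Rightarrow> bool" and S :: "'a set" and w
    assume A: "symp A" and S: "finite S" and W0: "0 < sum w S"
      and w: "\<forall>v\<in>S. 0 \<le> w v \<and> w v \<le> \<eta> * sum w S"
      and d: "\<forall>v\<in>S. (real (Suc r) - 1 + c) * sum w S \<le> real (Suc r) * deg w A S v"
    define W where "W = sum w S"
    have w0: "\<And>v. v \<in> S \<Longrightarrow> 0 \<le> w v" and W: "W > 0" using w W0 by (auto simp: W_def)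
    \<comment> \<open>The condition for \<open>Suc r\<close> implies the one for \<open>r\<close>:
      subtract \<open>deg w A S v \<le> sum w S\<close> once.\<close>
    have "\<forall>v\<in>S. (real r - 1 + c) * sum w S \<le> real r * deg w A S v"
    proof
      fix v assume "v \<in> S"
      with d have "(real (Suc r) - 1 + c) * sum w S \<le> real (Suc r) * deg w A S v" by blast
      moreover have "deg w A S v \<le> sum w S" by (rule deg_le[OF S]) (rule w0)
      ultimately show "(real r - 1 + c) * sum w S \<le> real r * deg w A S v"
        by (simp add: algebra_simps)
    qed
    moreover have "\<forall>v\<in>S. 0 \<le> w v \<and> w v \<le> \<eta>1 * sum w S"
      using w \<eta>(2) W0 by (meson less_imp_le mult_right_mono order_trans)
    ultimately obtain P0 where "multipartite A S k T P0"
      using IH[OF A S W0] unfolding k_def by blast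
    then obtain P where P: "multipartite A S k T P" and cP: "\<And>i. i < k \<Longrightarrow> card (P i) = T"
      by (rule multipartite_trim) blast
    have PS: "\<And>i. i < k \<Longrightarrow> P i \<subseteq> S" using P unfolding multipartite_def by blast
    have fP: "\<And>i. i < k \<Longrightarrow> finite (P i)" using PS S finite_subset by blast
    show "\<exists>P. multipartite A S (Suc (Suc r)) t P"
    proof (rule ccontr)
      assume "\<not> ?thesis"
      then have X: "card (common_neighbours A S P k t) \<le> M"
        using card_common_neighbours_le[OF S A P cP] unfolding M_def k_def by blast
      let ?X = "common_neighbours A S P k t"
      have XS: "?X \<subseteq> S" unfolding common_neighbours_def by blast
      have wX: "sum w ?X \<le> real M * \<eta> * W"
      proof -
        have "sum w ?X \<le> (\<Sum>v\<in>?X. \<eta> * W)" by (rule sum_mono) (use w XS in \<open>auto simp: W_def\<close>)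
        also have "\<dots> \<le> real M * (\<eta> * W)" using X \<eta> W by (simp add: mult_right_mono)
        finally show ?thesis by (simp add: mult_ac)
      qed
      \<comment> \<open>Double count of the weight between the parts and \<open>S\<close>. The
        degree condition gives the lower bound; for the upper bound each vertex is charged
        \<open>r * T + t\<close>, with an extra \<open>k * T\<close> for common neighbours.\<close>
      have "real T * (real r + c) * W = (\<Sum>i<k. \<Sum>u\<in>P i. (real r + c) * W / real k)"
        using cP by (simp add: k_def)
      also have "\<dots> \<le> (\<Sum>i<k. \<Sum>u\<in>P i. deg w A S u)"
      proof (intro sum_mono)
        fix i u assume "i \<in> {..<k}" "u \<in> P i"
        then have "u \<in> S" using PS by auto
        then have "(real r + c) * W \<le> real k * deg w A S u" using d by (simp add: W_def k_def)
        then show "(real r + c) * W / real k \<le> deg w A S u"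
          by (simp add: k_def divide_le_eq mult_ac)
      qed
      also have "\<dots> = (\<Sum>v\<in>S. w v * real (\<Sum>i<k. card {u\<in>P i. A v u}))"
        by (rule sum_deg_parts[OF S A fP])
      also have "\<dots> \<le> (\<Sum>v\<in>S. w v * (real r * real T + real t) + (if v \<in> ?X then w v * (real k * real T) else 0))"
      proof (rule sum_mono)
        fix v assume v: "v \<in> S"
        show "w v * real (\<Sum>i<k. card {u\<in>P i. A v u}) \<le>
          w v * (real r * real T + real t) + (if v \<in> ?X then w v * (real k * real T) else 0)"
        proof (cases "v \<in> ?X")
          case True
          have "real (\<Sum>i<k. card {u\<in>P i. A v u}) \<le> real (k * T)"
            using neighbours_in_parts_le[OF fP cP] by (intro of_nat_mono)
          then have "w v * real (\<Sum>i<k. card {u\<in>P i. A v u}) \<le> w v * (real k * real T)"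
            using w0[OF v] by (simp add: mult_left_mono)
          moreover have "0 \<le> w v * (real r * real T + real t)" using w0[OF v] by simp
          ultimately show ?thesis using True by simp
        next
          case False
          have "(\<Sum>i<k. card {u\<in>P i. A v u}) \<le> (k - 1) * T + t"
            using neighbours_in_parts_not_common[OF fP cP v False] by blast
          then have "real (\<Sum>i<k. card {u\<in>P i. A v u}) \<le> real ((k - 1) * T + t)"
            by (rule of_nat_mono)
          then have "real (\<Sum>i<k. card {u\<in>P i. A v u}) \<le> real r * real T + real t"
            by (simp add: k_def)
          then show ?thesis using w0[OF v] False by (simp add: mult_left_mono)
        qed
      qed
      also have "\<dots> = W * (real r * real T + real t) + sum w ?X * (real k * real T)"
        using S XS by (simp add: sum.distrib W_def sum_distrib_right[symmetric] sum.inter_restrict[symmetric] Int_absorb1)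
      also have "\<dots> \<le> W * (real r * real T + real t) + (real M * \<eta> * W) * (real k * real T)"
        using wX by (simp add: mult_right_mono)
      also have "\<dots> = W * (real r * real T + real t + (real M * \<eta> * real k) * real T)"
        by (simp add: algebra_simps)
      also have "\<dots> \<le> W * (real r * real T + real t + c / 2 * real T)"
        using M\<eta> W by (intro mult_left_mono add_left_mono mult_right_mono) auto
      finally have "W * (c / 2 * real T) \<le> W * real t" by (simp add: algebra_simps)
      then have "c / 2 * real T \<le> real t" using W by simp
      then show False using cT by simp
    qed
  qed (rule \<eta>(1))
qed

subsection \<open>A weighted Erdos--Stone theorem\<close>

lemma deg_remove:
  assumes "finite S" "v \<in> S"
  shows "deg w A S u = deg w A (S - {v}) u + (if A u v then w v else 0)"
proof -
  have "deg w A S u = (\<Sum>x\<in>S. if A u x then w x else 0)"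
    unfolding deg_def using assms by (simp add: sum.inter_filter)
  also have "\<dots> = (if A u v then w v else 0) + (\<Sum>x\<in>S-{v}. if A u x then w x else 0)"
    using assms by (simp add: sum.remove)
  also have "(\<Sum>x\<in>S-{v}. if A u x then w x else 0) = deg w A (S - {v}) u"
    unfolding deg_def by (rule sum.inter_filter[symmetric]) (use assms in simp)
  finally show ?thesis by simp
qed

text \<open>The factor 2 reflects ordered pairs; irreflexivity ensures that \<open>v\<close> does
  not count itself, so its degree in \<open>S\<close> is its degree in
  \<open>S - {v}\<close>.\<close>

lemma edge_weight_remove:
  assumes "finite S" "v \<in> S" "symp A" "irreflp A"
  shows "edge_weight w A S = edge_weight w A (S - {v}) + 2 * w v * deg w A S v"
proof -
  have sym: "A u v \<longleftrightarrow> A v u" for u using assms(3) by (meson sympD)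
  have irr: "\<not> A v v" using assms(4) by (meson irreflpD)
  have "edge_weight w A S = w v * deg w A S v + (\<Sum>u\<in>S-{v}. w u * deg w A S u)"
    unfolding edge_weight_def using assms by (simp add: sum.remove)
  also have "(\<Sum>u\<in>S-{v}. w u * deg w A S u) = edge_weight w A (S - {v}) + (\<Sum>u\<in>S-{v}. if A v u then w u * w v else 0)"
    unfolding edge_weight_def sum.distrib[symmetric]
    by (rule sum.cong) (use deg_remove[OF assms(1,2)] sym in \<open>auto simp: algebra_simps\<close>)
  also have "(\<Sum>u\<in>S-{v}. if A v u then w u * w v else 0) = (\<Sum>u\<in>S-{v}. if A v u then w u else 0) * w v"
    by (simp add: sum_distrib_right if_distrib[of "\<lambda>x. x * w v"] cong: if_cong)
  also have "(\<Sum>u\<in>S-{v}. if A v u then w u else 0) = deg w A (S - {v}) v"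
    unfolding deg_def by (rule sum.inter_filter[symmetric]) (use assms in simp)
  also have "\<dots> = deg w A S v" using deg_remove[OF assms(1,2), of w A v] irr by simp
  finally show ?thesis by simp
qed

lemma edge_weight_le:
  assumes "finite S" "\<And>v. v \<in> S \<Longrightarrow> 0 \<le> w v"
  shows "edge_weight w A S \<le> (sum w S)\<^sup>2"
proof -
  have "edge_weight w A S \<le> (\<Sum>v\<in>S. w v * sum w S)"
    unfolding edge_weight_def using assms by (intro sum_mono mult_left_mono deg_le) auto
  then show ?thesis by (simp add: sum_distrib_right[symmetric] power2_eq_square)
qed

text \<open>Deleting a vertex from a maximizer of \<open>edge_weight - \<alpha> (sum w)\<^sup>2\<close> cannot increase this
  quantity, which is exactly the minimum degree condition below.\<close>

lemma dense_core:
  fixes \<alpha> :: real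
  assumes "finite V" "symp A" "irreflp A" "\<And>v. v \<in> V \<Longrightarrow> 0 < w v"
  obtains S where "S \<subseteq> V"
    "edge_weight w A V - \<alpha> * (sum w V)\<^sup>2 \<le> edge_weight w A S - \<alpha> * (sum w S)\<^sup>2"
    "\<And>v. v \<in> S \<Longrightarrow> \<alpha> * (sum w S - w v / 2) \<le> deg w A S v"
proof -
  let ?g = "\<lambda>S. edge_weight w A S - \<alpha> * (sum w S)\<^sup>2"
  have fin: "finite (?g ` Pow V)" using assms(1) by simp
  then have "Max (?g ` Pow V) \<in> ?g ` Pow V" by (rule Max_in) auto
  then obtain S where S: "S \<subseteq> V" "Max (?g ` Pow V) = ?g S" by auto
  have max: "?g S' \<le> ?g S" if "S' \<subseteq> V" for S'
    unfolding S(2)[symmetric] using fin that by (intro Max_ge) auto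
  show thesis
  proof (rule that[OF S(1) max])
    fix v assume v: "v \<in> S"
    have fS: "finite S" using S(1) assms(1) by (rule finite_subset)
    have wv: "0 < w v" using v S(1) assms(4) by blast
    have W: "sum w (S - {v}) = sum w S - w v" using fS v by (simp add: sum.remove)
    have "?g (S - {v}) \<le> ?g S" by (rule max) (use S(1) in blast)
    \<comment> \<open>The squares differ by \<open>w v * (2 * sum w S - w v)\<close>. Cancelling the
      positive factor \<open>w v\<close> leaves the degree bound, and explains the correction
      \<open>w v / 2\<close>.\<close>
    then have "0 \<le> 2 * w v * deg w A S v - \<alpha> * (sum w S)\<^sup>2 + \<alpha> * (sum w S - w v)\<^sup>2"
      using edge_weight_remove[OF fS v assms(2,3), of w] W by simp
    also have "\<dots> = w v * (2 * deg w A S v - \<alpha> * (2 * sum w S - w v))"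
      by (simp add: power2_eq_square algebra_simps)
    finally have "0 \<le> 2 * deg w A S v - \<alpha> * (2 * sum w S - w v)"
      using wv by (simp add: zero_le_mult_iff)
    then show "\<alpha> * (sum w S - w v / 2) \<le> deg w A S v" by (simp add: algebra_simps)
  qed simp
qed

text \<open>The dense core at level \<open>1 - 1/r + c/2\<close> still carries a fixed amount of
  weight and has large minimum degree, so \<open>min_degree_blowup\<close> applies to it. The total
  is bounded by 1 rather than equal to 1 because the lemma is later applied to subsets of a
  normalized vertex set.\<close>

lemma erdos_stone_weighted:
  fixes c :: real
  assumes c: "c > 0" and r: "r \<ge> 1"
  shows "\<exists>\<eta>>0. \<forall>A (S :: 'a set) w. symp A \<longrightarrow> irreflp A \<longrightarrow> finite S \<longrightarrow>
     (\<forall>v\<in>S. 0 < w v \<and> w v \<le> \<eta>) \<longrightarrow> sum w S \<le> 1 \<longrightarrow>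
     (1 - 1 / real r) * (sum w S)\<^sup>2 + c \<le> edge_weight w A S \<longrightarrow>
     (\<exists>P. multipartite A S (Suc r) t P)"
proof -
  have c4: "c / 4 > 0" using c by simp
  obtain \<eta>1 where \<eta>1: "\<eta>1 > 0" and md: "\<And>A (S :: 'a set) w. symp A \<Longrightarrow> finite S \<Longrightarrow> 0 < sum w S \<Longrightarrow>
     (\<forall>v\<in>S. 0 \<le> w v \<and> w v \<le> \<eta>1 * sum w S) \<Longrightarrow>
     (\<forall>v\<in>S. (real r - 1 + c / 4) * sum w S \<le> real r * deg w A S v) \<Longrightarrow>
     (\<exists>P. multipartite A S (Suc r) t P)"
    using min_degree_blowup[OF c4, of r t, where 'a='a] by blast
  \<comment> \<open>The core will weigh at least \<open>c / 2\<close>. The first term turns absolute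
    smallness of weights into smallness relative to the core; the second absorbs the correction
    \<open>\<alpha> * w v / 2\<close> from \<open>dense_core\<close>.\<close>
  define \<eta> where "\<eta> = min (\<eta>1 * (c / 2)) (c\<^sup>2 / (8 * (1 + c)))"
  have \<eta>: "\<eta> > 0" "\<eta> \<le> \<eta>1 * (c / 2)" "(1 + c) * \<eta> \<le> c\<^sup>2 / 8"
  proof -
    show "\<eta> > 0" using \<eta>1 c by (auto simp: \<eta>_def)
    show "\<eta> \<le> \<eta>1 * (c / 2)" unfolding \<eta>_def by (rule min.cobounded1)
    have "(1 + c) * \<eta> \<le> (1 + c) * (c\<^sup>2 / (8 * (1 + c)))"
      by (rule mult_left_mono) (use c in \<open>auto simp: \<eta>_def\<close>)
    also have "\<dots> = c\<^sup>2 / 8" using c by (simp add: divide_simps)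
    finally show "(1 + c) * \<eta> \<le> c\<^sup>2 / 8" .
  qed
  show ?thesis
  proof (intro exI[of _ \<eta>] conjI allI impI)
    fix A :: "'a \<Rightarrow> 'a \<Rightarrow> bool" and V :: "'a set" and w
    assume A: "symp A" "irreflp A" and V: "finite V" and w: "\<forall>v\<in>V. 0 < w v \<and> w v \<le> \<eta>"
      and V1: "sum w V \<le> 1" and e: "(1 - 1 / real r) * (sum w V)\<^sup>2 + c \<le> edge_weight w A V"
    define \<alpha> where "\<alpha> = 1 - 1 / real r + c / 2"
    have "0 \<le> 1 / real r" "1 / real r \<le> 1" using r by auto
    then have \<alpha>: "0 \<le> \<alpha>" "\<alpha> \<le> 1 + c" using c unfolding \<alpha>_def by linarith+
    obtain S where S: "S \<subseteq> V"
      and big: "edge_weight w A V - \<alpha> * (sum w V)\<^sup>2 \<le> edge_weight w A S - \<alpha> * (sum w S)\<^sup>2"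
      and d: "\<And>v. v \<in> S \<Longrightarrow> \<alpha> * (sum w S - w v / 2) \<le> deg w A S v"
      using dense_core[OF V A, of w \<alpha>] w by blast
    have fS: "finite S" using S V by (rule finite_subset)
    have w0: "0 \<le> w v" if "v \<in> V" for v using w that by (simp add: less_imp_le)
    have VW0: "0 \<le> sum w V" using w0 by (intro sum_nonneg) auto
    have W0: "0 \<le> sum w S" using w0 S by (intro sum_nonneg) auto
    have W1: "sum w S \<le> 1" using sum_mono2[OF V S, of w] w0 V1 by fastforce
    \<comment> \<open>The core is not light: half of the excess \<open>c\<close> survives in its
      edge weight, which is at most the square of its total weight.\<close>
    have "c / 2 * (sum w V)\<^sup>2 \<le> c / 2 * 1"
      using V1 VW0 c by (intro mult_left_mono) (auto simp: power_le_one)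
    then have "c / 2 \<le> edge_weight w A V - \<alpha> * (sum w V)\<^sup>2"
      using e by (simp add: \<alpha>_def algebra_simps)
    also have "\<dots> \<le> edge_weight w A S" using big \<alpha> by (smt (verit) mult_nonneg_nonneg zero_le_power2)
    also have "\<dots> \<le> (sum w S)\<^sup>2" using w0 S by (intro edge_weight_le[OF fS]) auto
    also have "\<dots> \<le> sum w S" using W0 W1 by (simp add: power2_eq_square mult_left_le_one_le)
    finally have W: "c / 2 \<le> sum w S" .
    have "\<exists>P. multipartite A S (Suc r) t P"
    proof (rule md[OF A(1) fS])
      show "0 < sum w S" using W c by simp
      show "\<forall>v\<in>S. 0 \<le> w v \<and> w v \<le> \<eta>1 * sum w S"
      proof
        fix v assume "v \<in> S"
        then have "v \<in> V" using S by blast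
        then have "w v \<le> \<eta>1 * (c / 2)" using w \<eta>(2) by (meson order_trans)
        also have "\<dots> \<le> \<eta>1 * sum w S" using W \<eta>1 by simp
        finally show "0 \<le> w v \<and> w v \<le> \<eta>1 * sum w S" using w0[OF \<open>v \<in> V\<close>] by simp
      qed
      show "\<forall>v\<in>S. (real r - 1 + c / 4) * sum w S \<le> real r * deg w A S v"
      proof
        fix v assume v: "v \<in> S"
        then have "v \<in> V" using S by blast
        have "\<alpha> * w v \<le> (1 + c) * \<eta>"
          by (rule mult_mono) (use \<alpha> w \<open>v \<in> V\<close> c in \<open>auto simp: less_imp_le\<close>)
        also have "\<dots> \<le> (c / 4) * (c / 2)" using \<eta>(3) by (simp add: power2_eq_square)
        also have "\<dots> \<le> c / 4 * sum w S" using W c by (intro mult_left_mono) auto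
        finally have "\<alpha> * w v \<le> c / 4 * sum w S" .
        moreover have "(1 - 1 / real r + c / 4) * sum w S = \<alpha> * sum w S - c / 4 * sum w S"
          by (simp add: \<alpha>_def algebra_simps)
        moreover have "\<alpha> * (sum w S - w v / 2) = \<alpha> * sum w S - (\<alpha> * w v) / 2"
          by (simp add: algebra_simps)
        moreover have "0 \<le> c / 4 * sum w S" using W0 c by simp
        ultimately have "(1 - 1 / real r + c / 4) * sum w S \<le> \<alpha> * (sum w S - w v / 2)"
          by linarith
        also have "\<dots> \<le> deg w A S v" by (rule d[OF v])
        finally have "real r * ((1 - 1 / real r + c / 4) * sum w S) \<le> real r * deg w A S v"
          by (simp add: mult_left_mono)
        moreover have "real r * ((1 - 1 / real r + c / 4) * sum w S) = (real r - 1 + real r * (c / 4)) * sum w S"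
          using r by (simp add: field_simps)
        moreover have "(real r - 1 + c / 4) * sum w S \<le> (real r - 1 + real r * (c / 4)) * sum w S"
          using W0 r c by (intro mult_right_mono) (auto simp: mult_le_cancel_right1)
        ultimately show "(real r - 1 + c / 4) * sum w S \<le> real r * deg w A S v" by linarith
      qed
    qed
    then show "\<exists>P. multipartite A V (Suc r) t P" using S multipartite_mono by blast
  qed (rule \<eta>(1))
qed

text \<open>Pigeonhole on the neighbourhoods in \<open>P\<close> makes each side of the bipartite graph \<open>Q\<close> uniform; the
  two uniform sides replace the part \<open>P i0\<close>, and the other parts shrink to common neighbourhoods.\<close>

lemma extend_by_dense_class:
  assumes V: "finite V" and A: "symp A"
    and P: "multipartite A V r T P" "\<And>i. i < r \<Longrightarrow> card (P i) = T"
    and i0: "i0 < r" and U: "U \<subseteq> V"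
    and L: "\<And>v j. v \<in> U \<Longrightarrow> j < r \<Longrightarrow> j \<noteq> i0 \<Longrightarrow> L \<le> card {u\<in>P j. A v u}" "T + t \<le> 2 * L"
    and Q: "multipartite A U 2 (t * 2 ^ (r * T) + 1) Q"
  shows "\<exists>R. multipartite A V (Suc r) t R"
proof -
  let ?Y = "\<Union>i<r. P i"
  let ?f = "\<lambda>v. {u\<in>?Y. A v u}"
  have sym: "A u v \<Longrightarrow> A v u" for u v using A by (rule sympD)
  have PV: "P i \<subseteq> V" if "i < r" for i using P(1) that unfolding multipartite_def by blast
  have PA: "A u v" if "i < r" "j < r" "i \<noteq> j" "u \<in> P i" "v \<in> P j" for i j u v
    using P(1) that unfolding multipartite_def by blast
  have finY: "finite ?Y" using V PV by (meson UN_least finite_subset lessThan_iff)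
  have cY: "card (Pow ?Y) \<le> 2 ^ (r * T)"
    using card_Union_parts_le[of r P T] P(2) finY by (simp add: card_Pow)
  have QU: "Q i \<subseteq> U" "t * 2 ^ (r * T) < card (Q i)" if "i < 2" for i
    using Q that unfolding multipartite_def by (auto simp: Suc_le_eq)
  have QA: "A u v" if "u \<in> Q 0" "v \<in> Q 1" for u v
    using Q that unfolding multipartite_def
    by (metis One_nat_def Suc_1 lessI less_2_cases_iff zero_neq_one)
  have fib: "\<exists>y \<in> ?f ` Q i. t \<le> card {x\<in>Q i. ?f x = y}" if "i < 2" for i
  proof -
    have "finite (Q i)" using QU(1)[OF that] U V by (meson finite_subset)
    moreover have "?f ` Q i \<subseteq> Pow ?Y" by blast
    moreover have "finite (Pow ?Y)" using finY by simp
    moreover note cY QU(2)[OF that]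
    ultimately obtain y where "y \<in> ?f ` Q i" "t \<le> card {x\<in>Q i. ?f x = y}"
      by (rule large_fibre)
    then show ?thesis by (rule bexI[rotated])
  qed
  obtain y0 where y0: "y0 \<in> ?f ` Q 0" "t \<le> card {x\<in>Q 0. ?f x = y0}" using fib[of 0] by auto
  obtain y1 where y1: "y1 \<in> ?f ` Q 1" "t \<le> card {x\<in>Q 1. ?f x = y1}" using fib[of 1] by auto
  define Q0 where "Q0 = {x\<in>Q 0. ?f x = y0}"
  define Q1 where "Q1 = {x\<in>Q 1. ?f x = y1}"
  have Q01: "t \<le> card Q0" "t \<le> card Q1" using y0(2) y1(2) by (simp_all only: Q0_def Q1_def)
  have Q0A: "A x u" if "x \<in> Q0" "u \<in> y0" for x u using that unfolding Q0_def by blast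
  have Q1A: "A x u" if "x \<in> Q1" "u \<in> y1" for x u using that unfolding Q1_def by blast
  have Q01A: "A x u" if "x \<in> Q0" "u \<in> Q1" for x u using that QA unfolding Q0_def Q1_def by blast
  have Q01V: "Q0 \<subseteq> V" "Q1 \<subseteq> V" using QU(1)[of 0] QU(1)[of 1] U by (auto simp: Q0_def Q1_def)
  have "L \<le> card (P j \<inter> y)" if "j < r" "j \<noteq> i0" "i < 2" "y \<in> ?f ` Q i" for j i y
  proof -
    obtain x where x: "x \<in> Q i" "y = ?f x" using \<open>y \<in> ?f ` Q i\<close> by blast
    then have "P j \<inter> y = {u\<in>P j. A x u}" using \<open>j < r\<close> by blast
    moreover have "x \<in> U" using x(1) QU(1)[OF \<open>i < 2\<close>] by blast
    ultimately show ?thesis using L(1)[of x j] \<open>j < r\<close> \<open>j \<noteq> i0\<close> by simp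
  qed
  then have Ly: "L \<le> card (P j \<inter> y0)" "L \<le> card (P j \<inter> y1)" if "j < r" "j \<noteq> i0" for j
    using that y0(1) y1(1) by (meson pos2 one_less_numeral_iff semiring_norm(76))+
  \<comment> \<open>Inclusion and exclusion inside a part of size \<open>T\<close>: two subsets of
    size at least \<open>L\<close> meet in at least \<open>2 * L - T\<close> vertices.\<close>
  have tP: "t \<le> card (P j \<inter> y0 \<inter> y1)" if j: "j < r" "j \<noteq> i0" for j
  proof -
    have fin: "finite (P j)" using PV[OF j(1)] V finite_subset by blast
    have "card (P j \<inter> y0) + card (P j \<inter> y1) = card (P j \<inter> y0 \<union> P j \<inter> y1) + card (P j \<inter> y0 \<inter> (P j \<inter> y1))"
      using fin by (intro card_Un_Int) auto
    moreover have "card (P j \<inter> y0 \<union> P j \<inter> y1) \<le> T"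
      using P(2)[OF j(1)] fin by (metis Int_lower1 Un_least card_mono)
    moreover have "P j \<inter> y0 \<inter> (P j \<inter> y1) = P j \<inter> y0 \<inter> y1" by blast
    ultimately show ?thesis using Ly[OF j] L(2) by simp
  qed
  \<comment> \<open>\<open>Q0\<close> takes over the index \<open>i0\<close>, and \<open>Q1\<close>
    is the new part with index \<open>r\<close>.\<close>
  define R where "R = (\<lambda>j. if j = r then Q1 else if j = i0 then Q0 else P j \<inter> y0 \<inter> y1)"
  have "multipartite A V (Suc r) t R"
    unfolding multipartite_def
  proof (intro conjI allI impI ballI)
    fix i assume "i < Suc r"
    then show "R i \<subseteq> V" "t \<le> card (R i)" using PV[of i] Q01V Q01 tP[of i] by (auto simp: R_def)
  next
    have *: "A u v" if "j < r" "j \<noteq> i0" "u \<in> R j" "v \<in> Q0 \<union> Q1" for j u v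
    proof -
      have "u \<in> y0" "u \<in> y1" using that by (auto simp: R_def)
      then show ?thesis using that(4) Q0A Q1A sym by blast
    qed
    fix i j u v assume ij: "i < Suc r" "j < Suc r" "i \<noteq> j" "u \<in> R i" "v \<in> R j"
    have R: "R r = Q1" "R i0 = Q0" using i0 by (auto simp: R_def)
    show "A u v"
    proof (cases "i < r \<and> i \<noteq> i0")
      case True
      show ?thesis
      proof (cases "j < r \<and> j \<noteq> i0")
        case False
        then have "v \<in> Q0 \<union> Q1" using ij R by (cases "j = r") auto
        then show ?thesis using * True ij by blast
      next
        case j: True
        then show ?thesis using True ij PA[of i j u v] by (auto simp: R_def)
      qed
    next
      case False
      then have u: "u \<in> Q0 \<union> Q1" using ij R by (cases "i = r") auto
      show ?thesis
      proof (cases "j < r \<and> j \<noteq> i0")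
        case True
        then show ?thesis using *[of j v u] u ij sym by blast
      next
        case j: False
        then have "i = r \<and> j = i0 \<or> i = i0 \<and> j = r" using False ij by linarith
        then show ?thesis using ij R Q01A sym by auto
      qed
    qed
  qed
  then show ?thesis by blast
qed

subsection \<open>Stability: partitioning a dense graph\<close>

lemma deg_const: "deg (\<lambda>_. a) A S v = a * real (card {u\<in>S. A v u})"
  unfolding deg_def by simp

lemma edge_weight_const:
  assumes "finite S"
  shows "edge_weight (\<lambda>_. a) A S = a\<^sup>2 * real (card {(u, v) \<in> S \<times> S. A u v})"
proof -
  have "{(u, v) \<in> S \<times> S. A u v} = (SIGMA u:S. {v\<in>S. A u v})" by auto
  then show ?thesis
    unfolding edge_weight_def deg_const using assms
    by (simp add: sum_distrib_left power2_eq_square mult_ac)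
qed

text \<open>\<open>G\<close> consists of the vertices with at least \<open>(r - 1) * 8q - q\<close> neighbours in \<open>P\<close> but fewer than
  \<open>t\<close> in some part \<open>P (c v)\<close>.  Such a vertex sees at least \<open>5q\<close> of the \<open>8q\<close> vertices in each other
  part, so two of them always share many neighbours there.\<close>

lemma typical_classes:
  fixes b :: real
  assumes V: "finite V" "S \<subseteq> V" and A: "symp A" and r: "r \<ge> 2" and q: "q > 0" "t \<le> q"
    and no: "\<nexists>Q. multipartite A V (Suc r) t Q"
    and P: "multipartite A S r (8 * q) P" "\<And>i. i < r \<Longrightarrow> card (P i) = 8 * q"
    and d: "\<And>u. u \<in> S \<Longrightarrow> (real r - 1 - b) * real (card S) \<le> real r * real (card {v\<in>S. A u v})"
  obtains G c where "G \<subseteq> S" "\<And>v. c v < r"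
    "real q * real (card (S - G)) \<le> 8 * real q * b * real (card S) + real t * real (card S)
       + 9 * real q * real (t * 2 ^ (r * (8 * q)))"
    "\<And>i. i < r \<Longrightarrow> \<nexists>Q. multipartite A {v\<in>G. c v = i} 2 (t * 2 ^ (r * (8 * q)) + 1) Q"
proof -
  define M where "M = t * 2 ^ (r * (8 * q))"
  define nb where "nb v = (\<Sum>i<r. card {u\<in>P i. A v u})" for v
  define X where "X = common_neighbours A S P r t"
  define B where "B = {v\<in>S - X. nb v + q < (r - 1) * (8 * q)}"
  define G where "G = S - X - B"
  have fS: "finite S" using V by (rule rev_finite_subset)
  have PS: "P i \<subseteq> S" if "i < r" for i using P(1) that unfolding multipartite_def by blast
  have fP: "finite (P i)" if "i < r" for i using PS[OF that] fS by (rule finite_subset)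
  have noS: "\<nexists>Q. multipartite A S (Suc r) t Q" using no V(2) multipartite_mono by blast
  have X: "card X \<le> M" unfolding X_def M_def by (rule card_common_neighbours_le[OF fS A P noS])
  have XS: "X \<subseteq> S" "B \<subseteq> S" "X \<inter> B = {}" by (auto simp: X_def B_def common_neighbours_def)
  have fXB: "finite X" "finite B" using XS fS finite_subset by blast+
  have few: "v \<in> S \<Longrightarrow> v \<notin> X \<Longrightarrow> \<exists>i<r. card {u\<in>P i. A v u} < t" for v
    unfolding X_def common_neighbours_def by auto
  \<comment> \<open>Any part that \<open>v\<close> hardly sees may serve as its class. The default 0
    outside \<open>G\<close> is a valid index since \<open>r\<close> is positive.\<close>
  define c where "c v = (if v \<in> G then SOME i. i < r \<and> card {u\<in>P i. A v u} < t else 0)" for v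
  have cG: "c v < r \<and> card {u\<in>P (c v). A v u} < t" if "v \<in> G" for v
  proof -
    have "\<exists>i. i < r \<and> card {u\<in>P i. A v u} < t" using few[of v] that by (auto simp: G_def)
    from someI_ex[OF this] show ?thesis using that by (simp add: c_def)
  qed
  \<comment> \<open>Double count between the parts and \<open>S\<close>. Against the baseline
    \<open>(r - 1) * 8q + t\<close>, a vertex of \<open>X\<close> may gain \<open>8q\<close> while
    one of \<open>B\<close> loses at least \<open>q\<close>. Since \<open>X\<close> is bounded and
    the average is nearly attained, \<open>B\<close> is small.\<close>
  have "real (8 * q) * (real r - 1 - b) * real (card S) =
      (\<Sum>i<r. \<Sum>u\<in>P i. (real r - 1 - b) * real (card S) / real r)"
    using P(2) r by simp
  also have "\<dots> \<le> (\<Sum>i<r. \<Sum>u\<in>P i. deg (\<lambda>_. 1) A S u)"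
  proof (intro sum_mono)
    fix i u assume "i \<in> {..<r}" "u \<in> P i"
    then have "u \<in> S" using PS by auto
    from d[OF this] show "(real r - 1 - b) * real (card S) / real r \<le> deg (\<lambda>_. 1) A S u"
      using r by (simp add: deg_const divide_le_eq mult.commute)
  qed
  also have "\<dots> = (\<Sum>v\<in>S. real (nb v))"
    using sum_deg_parts[where w = "\<lambda>_. 1", OF fS A fP] unfolding nb_def by simp
  also have "\<dots> \<le> (\<Sum>v\<in>S. ((real r - 1) * real (8 * q) + real t) +
      ((if v \<in> X then real (8 * q) else 0) - (if v \<in> B then real q else 0)))"
  proof (rule sum_mono)
    fix v assume v: "v \<in> S"
    have r1: "real (r - 1) = real r - 1" using r by simp
    show "real (nb v) \<le> ((real r - 1) * real (8 * q) + real t) +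
      ((if v \<in> X then real (8 * q) else 0) - (if v \<in> B then real q else 0))"
    proof (cases "v \<in> X")
      case True
      have "nb v \<le> r * (8 * q)" unfolding nb_def by (rule neighbours_in_parts_le[OF fP P(2)])
      then have "real (nb v) \<le> real r * real (8 * q)" by (metis of_nat_le_iff of_nat_mult)
      moreover have "v \<notin> B" using True XS by blast
      ultimately show ?thesis using True by (simp add: algebra_simps)
    next
      case False
      show ?thesis
      proof (cases "v \<in> B")
        case True
        then have "nb v + q \<le> (r - 1) * (8 * q)" by (simp add: B_def)
        then have "real (nb v) + real q \<le> (real r - 1) * real (8 * q)"
          unfolding r1[symmetric] by (metis of_nat_le_iff of_nat_mult of_nat_add)
        then show ?thesis using True False by simp
      next
        case vB: False
        have "nb v \<le> (r - 1) * (8 * q) + t"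
          unfolding nb_def using neighbours_in_parts_not_common[OF fP P(2) v False[unfolded X_def]] by blast
        then have "real (nb v) \<le> (real r - 1) * real (8 * q) + real t"
          unfolding r1[symmetric] by (metis of_nat_le_iff of_nat_mult of_nat_add)
        then show ?thesis using vB False by simp
      qed
    qed
  qed
  also have "\<dots> = real (card S) * ((real r - 1) * real (8 * q) + real t)
      + (real (8 * q) * real (card X) - real q * real (card B))"
    using fS XS by (simp only: sum.distrib sum_subtractf sum.inter_restrict[symmetric] Int_absorb1)
      (simp add: algebra_simps)
  finally have count: "real q * real (card B) \<le> 8 * real q * b * real (card S) + real t * real (card S)
      + 8 * real q * real (card X)"
    by (simp add: algebra_simps)
  have "S - G = X \<union> B" using XS by (auto simp: G_def)
  then have "card (S - G) \<le> card X + card B" by (simp add: card_Un_le)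
  then have "real q * real (card (S - G)) \<le> real q * real (card X + card B)"
    by (intro mult_left_mono of_nat_mono) auto
  also have "\<dots> \<le> 8 * real q * b * real (card S) + real t * real (card S) + 9 * real q * real (card X)"
    using count by (simp add: algebra_simps)
  also have "\<dots> \<le> 8 * real q * b * real (card S) + real t * real (card S) + 9 * real q * real M"
    using X by (intro add_left_mono mult_left_mono of_nat_mono) auto
  finally have bound: "real q * real (card (S - G)) \<le> 8 * real q * b * real (card S)
      + real t * real (card S) + 9 * real q * real M" .
  \<comment> \<open>The part \<open>c v\<close> contributes less than \<open>t \<le> q\<close> and
    the other \<open>r - 2\<close> parts at most \<open>8q\<close> each, so the deficit of at most
    \<open>q\<close> in \<open>nb v\<close> leaves more than \<open>6q\<close> for
    \<open>P j\<close>.\<close>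
  have dense: "5 * q \<le> card {u\<in>P j. A v u}" if v: "v \<in> G" and j: "j < r" "j \<noteq> c v" for v j
  proof -
    have ci: "c v < r" "card {u\<in>P (c v). A v u} < t" using cG[OF v] by auto
    have "(\<Sum>i\<in>{..<r} - {c v} - {j}. card {u\<in>P i. A v u}) \<le> (\<Sum>i\<in>{..<r} - {c v} - {j}. 8 * q)"
      by (rule sum_mono) (metis (no_types, lifting) P(2) fP card_mono DiffD1 lessThan_iff mem_Collect_eq subsetI)
    also have "\<dots> = (r - 2) * (8 * q)" using ci(1) j by (simp add: card_Diff_subset numeral_2_eq_2)
    finally have rest: "(\<Sum>i\<in>{..<r} - {c v} - {j}. card {u\<in>P i. A v u}) \<le> (r - 2) * (8 * q)" .
    have "nb v = card {u\<in>P (c v). A v u} + (card {u\<in>P j. A v u}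
        + (\<Sum>i\<in>{..<r} - {c v} - {j}. card {u\<in>P i. A v u}))"
      unfolding nb_def using ci(1) j
      by (subst sum.remove[of _ "c v"], simp, simp, subst sum.remove[of _ j]) auto
    moreover have "(r - 1) * (8 * q) \<le> nb v + q" using v by (auto simp: G_def B_def)
    moreover have "(r - 1) * (8 * q) = (r - 2) * (8 * q) + 8 * q"
      using r by (metis Suc_1 Suc_diff_Suc add.commute diff_Suc_1' less_eq_Suc_le mult_Suc plus_1_eq_Suc)
    ultimately show ?thesis using ci(2) rest q by linarith
  qed
  have "\<nexists>Q. multipartite A {v\<in>G. c v = i} 2 (M + 1) Q" if i: "i < r" for i
  proof
    assume "\<exists>Q. multipartite A {v\<in>G. c v = i} 2 (M + 1) Q"
    then obtain Q where Q: "multipartite A {v\<in>G. c v = i} 2 (t * 2 ^ (r * (8 * q)) + 1) Q"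
      unfolding M_def by blast
    have "\<exists>R. multipartite A V (Suc r) t R"
    proof (rule extend_by_dense_class[OF V(1) A _ P(2) i _ _ _ Q])
      show "multipartite A V r (8 * q) P" using P(1) V(2) multipartite_mono by blast
      show "{v\<in>G. c v = i} \<subseteq> V" using V(2) by (auto simp: G_def)
      show "5 * q \<le> card {u\<in>P j. A v u}" if "v \<in> {v\<in>G. c v = i}" "j < r" "j \<noteq> i" for v j
        using dense that by blast
      show "8 * q + t \<le> 2 * (5 * q)" using q by simp
    qed auto
    then show False using no by blast
  qed
  moreover have "c v < r" for v using cG r by (cases "v \<in> G") (auto simp: c_def)
  moreover have "G \<subseteq> S" by (auto simp: G_def)
  ultimately show thesis using that bound unfolding M_def by blast
qed

lemma one_over_nat_le:
  fixes n :: nat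
  assumes "real n \<ge> 1 / \<eta>" "\<eta> > 0"
  shows "1 / real n \<le> \<eta>"
proof -
  have "0 < 1 / \<eta>" using assms by simp
  then have "0 < real n" using assms by linarith
  then show ?thesis using assms by (simp add: field_simps)
qed

text \<open>Weighted Erdos--Stone, applied to the dense core, shows that the core contains almost
  all vertices. Its degrees yield a complete \<open>r\<close>-partite subgraph, around which
  \<open>typical_classes\<close> groups nearly every vertex. The colouring counts few inner edges
  because each class excludes a large complete bipartite graph.\<close>

lemma stability_partition:
  fixes \<kappa> :: real
  assumes \<kappa>: "\<kappa> > 0" and r: "r \<ge> 2"
  shows "\<exists>\<delta>>0. \<exists>n0::nat. \<forall>A (V :: 'a set). symp A \<longrightarrow> irreflp A \<longrightarrow> finite V \<longrightarrow> n0 \<le> card V \<longrightarrow>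
     (\<nexists>P. multipartite A V (Suc r) t P) \<longrightarrow>
     (1 - 1 / real r - \<delta>) * (real (card V))\<^sup>2 \<le> real (card {(u, v) \<in> V \<times> V. A u v}) \<longrightarrow>
     (\<exists>c. (\<forall>v. c v < r) \<and> real (card {(u, v) \<in> V \<times> V. A u v \<and> c u = c v}) \<le> \<kappa> * (real (card V))\<^sup>2)"
proof -
  \<comment> \<open>The first term leaves the core degree above the threshold for \<open>r\<close>
    parts; the second makes pairs meeting the exceptional vertices cost at most half of
    \<open>\<kappa>\<close>.\<close>
  define \<beta> where "\<beta> = min (1 / (4 * (real r)\<^sup>2)) (\<kappa> / (4 * (16 * real r + 11)))"
  have \<beta>0: "\<beta> > 0" using \<kappa> r by (simp add: \<beta>_def)
  have \<beta>r: "4 * (real r)\<^sup>2 * \<beta> \<le> 1"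
  proof -
    have "4 * (real r)\<^sup>2 * \<beta> \<le> 4 * (real r)\<^sup>2 * (1 / (4 * (real r)\<^sup>2))"
      by (intro mult_left_mono) (auto simp: \<beta>_def)
    then show ?thesis using r by simp
  qed
  have \<beta>\<kappa>: "4 * ((16 * real r + 11) * \<beta>) \<le> \<kappa>"
  proof -
    have "\<beta> \<le> \<kappa> / (4 * (16 * real r + 11))" by (simp add: \<beta>_def)
    moreover have "0 < 4 * (16 * real r + 11)" by simp
    ultimately show ?thesis by (simp only: pos_le_divide_eq mult_ac)
  qed
  have "(4::real) \<le> (real r)\<^sup>2" using power_mono[of 2 "real r" 2] r by simp
  then have "16 * \<beta> \<le> 4 * (real r)\<^sup>2 * \<beta>" using \<beta>0 by simp
  then have \<beta>16: "\<beta> \<le> 1 / 16" using \<beta>r by linarith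
  define q where "q = nat \<lceil>real t / \<beta>\<rceil> + t + 1"
  have q: "q > 0" "t \<le> q" by (auto simp: q_def)
  have "real t / \<beta> \<le> real q" unfolding q_def using real_nat_ceiling_ge[of "real t / \<beta>"] by simp
  then have tq: "real t \<le> \<beta> * real q" using \<beta>0 by (simp add: field_simps)
  define M where "M = t * 2 ^ (r * (8 * q))"
  \<comment> \<open>Comparing the core with the whole graph will give
    \<open>\<beta> - 2 * \<delta> \<le> \<beta> * s^2\<close>, which for this
    \<open>\<delta>\<close> reads \<open>1 - \<beta> \<le> s^2\<close>.\<close>
  define \<delta> where "\<delta> = \<beta>\<^sup>2 / 2"
  have \<delta>0: "\<delta> > 0" using \<beta>0 by (simp add: \<delta>_def)
  have c1: "0 < \<kappa> / (2 * real r)" using \<kappa> r by simp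
  have c2: "0 < 1 / (2 * real r)" using r by simp
  have r1: "1 \<le> r" using r by simp
  obtain \<eta>0 where \<eta>0: "\<eta>0 > 0" and es: "\<And>A (S :: 'a set) w. symp A \<Longrightarrow> irreflp A \<Longrightarrow> finite S \<Longrightarrow>
     (\<forall>v\<in>S. 0 < w v \<and> w v \<le> \<eta>0) \<Longrightarrow> sum w S \<le> 1 \<Longrightarrow>
     (1 - 1 / real r) * (sum w S)\<^sup>2 + \<delta> \<le> edge_weight w A S \<Longrightarrow> (\<exists>P. multipartite A S (Suc r) t P)"
    using erdos_stone_weighted[OF \<delta>0 r1, of t, where 'a='a] by blast
  \<comment> \<open>The case \<open>r = 1\<close>, where the threshold \<open>1 - 1/1\<close>
    vanishes: positive edge density alone gives a large complete bipartite graph.\<close>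
  obtain \<eta>2 where \<eta>2: "\<eta>2 > 0" and es2: "\<And>A (S :: 'a set) w. symp A \<Longrightarrow> irreflp A \<Longrightarrow> finite S \<Longrightarrow>
     (\<forall>v\<in>S. 0 < w v \<and> w v \<le> \<eta>2) \<Longrightarrow> sum w S \<le> 1 \<Longrightarrow>
     (1 - 1 / real 1) * (sum w S)\<^sup>2 + \<kappa> / (2 * real r) \<le> edge_weight w A S \<Longrightarrow>
     (\<exists>P. multipartite A S (Suc 1) (M + 1) P)"
    using erdos_stone_weighted[OF c1 order_refl, of "M + 1", where 'a='a] by blast
  \<comment> \<open>Only \<open>r\<close> parts are sought, one fewer than the excluded number; a
    degree near \<open>1 - 1/r\<close> exceeds the threshold for \<open>r\<close> parts by a
    margin.\<close>
  obtain \<eta>1 where \<eta>1: "\<eta>1 > 0" and md: "\<And>A (S :: 'a set) w. symp A \<Longrightarrow> finite S \<Longrightarrow> 0 < sum w S \<Longrightarrow>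
     (\<forall>v\<in>S. 0 \<le> w v \<and> w v \<le> \<eta>1 * sum w S) \<Longrightarrow>
     (\<forall>v\<in>S. (real (r - 1) - 1 + 1 / (2 * real r)) * sum w S \<le> real (r - 1) * deg w A S v) \<Longrightarrow>
     (\<exists>P. multipartite A S (Suc (r - 1)) (8 * q) P)"
    using min_degree_blowup[OF c2, of "r - 1" "8 * q", where 'a='a] by blast
  define n0 where "n0 = nat \<lceil>1 / \<eta>0 + 2 / \<eta>1 + 1 / \<eta>2 + 1 / \<beta> + real M / \<beta>\<rceil>"
  have n0: "1 / \<eta>0 + 2 / \<eta>1 + 1 / \<eta>2 + 1 / \<beta> + real M / \<beta> \<le> real n0"
    unfolding n0_def by (rule real_nat_ceiling_ge)
  show ?thesis
  proof (intro exI[of _ \<delta>] conjI exI[of _ n0] allI impI)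
    show "\<delta> > 0" by (rule \<delta>0)
    fix A :: "'a \<Rightarrow> 'a \<Rightarrow> bool" and V :: "'a set"
    assume A: "symp A" "irreflp A" and V: "finite V" and nV: "n0 \<le> card V"
      and no: "\<nexists>P. multipartite A V (Suc r) t P"
      and e: "(1 - 1 / real r - \<delta>) * (real (card V))\<^sup>2 \<le> real (card {(u, v) \<in> V \<times> V. A u v})"
    define n where "n = card V"
    have "0 \<le> 1 / \<eta>0" "0 \<le> 2 / \<eta>1" "0 \<le> 1 / \<eta>2" "0 < 1 / \<beta>" "0 \<le> real M / \<beta>"
      using \<eta>0 \<eta>1 \<eta>2 \<beta>0 by auto
    moreover have "real n0 \<le> real n" using nV by (simp add: n_def)
    ultimately have nb: "1 / \<eta>0 \<le> real n" "2 / \<eta>1 \<le> real n" "1 / \<eta>2 \<le> real n"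
      "1 / \<beta> \<le> real n" "real M / \<beta> \<le> real n" "0 < real n"
      using n0 by linarith+
    have small: "1 / real n \<le> \<eta>0" "1 / real n \<le> \<eta>1 / 2" "1 / real n \<le> \<eta>2" "1 / real n \<le> \<beta>"
      using one_over_nat_le[of _ n] one_over_nat_le[of "\<eta>1 / 2" n] nb \<eta>0 \<eta>1 \<eta>2 \<beta>0 by simp_all
    have Mn: "real M \<le> \<beta> * real n" using nb(5) \<beta>0 by (simp add: field_simps)
    define w where "w = (\<lambda>_::'a. 1 / real n)"
    have wpos: "0 < w v" for v using nb by (simp add: w_def)
    have sw: "sum w S = real (card S) / real n" for S by (simp add: w_def)
    have ew: "edge_weight w A S = real (card {(u, v) \<in> S \<times> S. A u v}) / (real n)\<^sup>2" if "finite S" for S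
      unfolding w_def edge_weight_const[OF that] by (simp add: power_divide)
    have sV: "sum w V = 1" using nb by (simp add: sw n_def)
    define \<alpha> where "\<alpha> = 1 - 1 / real r - \<beta>"
    have ir: "0 < 1 / real r" "1 / real r \<le> 1 / 2" using r by auto
    have \<alpha>: "0 \<le> \<alpha>" "\<alpha> \<le> 1" using ir \<beta>16 \<beta>0 unfolding \<alpha>_def by linarith+
    obtain S where S: "S \<subseteq> V"
      and big: "edge_weight w A V - \<alpha> * (sum w V)\<^sup>2 \<le> edge_weight w A S - \<alpha> * (sum w S)\<^sup>2"
      and d: "\<And>v. v \<in> S \<Longrightarrow> \<alpha> * (sum w S - w v / 2) \<le> deg w A S v"
      using dense_core[OF V A, of w \<alpha>] wpos by blast
    have fS: "finite S" using S V by (rule finite_subset)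
    define s where "s = sum w S"
    have cS: "real (card S) = s * real n" using nb by (simp add: s_def sw)
    have "card S \<le> n" unfolding n_def using card_mono[OF V S] .
    then have s1: "s \<le> 1" and s0: "0 \<le> s" using nb by (auto simp: s_def sw)
    have "(1 - 1 / real r - \<delta>) \<le> edge_weight w A V"
      using e nb by (simp add: ew[OF V] n_def field_simps)
    \<comment> \<open>Erdos--Stone caps the core from above while its maximality bounds it from
      below; the two together force its weight \<open>s\<close> close to 1.\<close>
    moreover have "edge_weight w A S < (1 - 1 / real r) * s\<^sup>2 + \<delta>"
    proof (rule ccontr)
      assume "\<not> ?thesis"
      then have "\<exists>P. multipartite A S (Suc r) t P"
        using es[OF A fS, of w] wpos small s1 by (simp add: s_def w_def)
      then show False using no S multipartite_mono by blast
    qed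
    ultimately have "\<beta> - 2 * \<delta> \<le> (1 - 1 / real r) * s\<^sup>2 - \<alpha> * s\<^sup>2"
      using big by (simp add: sV \<alpha>_def s_def)
    also have "\<dots> = \<beta> * s\<^sup>2" by (simp add: \<alpha>_def algebra_simps)
    finally have "\<beta> * (1 - \<beta>) \<le> \<beta> * s\<^sup>2" by (simp add: \<delta>_def power2_eq_square algebra_simps)
    then have "1 - \<beta> \<le> s\<^sup>2" using \<beta>0 by simp
    also have "\<dots> \<le> s" using s0 s1 by (simp add: power2_eq_square mult_left_le_one_le)
    finally have s: "1 - \<beta> \<le> s" .
    have deg: "(1 - 1 / real r - 2 * \<beta>) * s \<le> deg w A S v" if "v \<in> S" for v
    proof -
      have "\<alpha> * (w v / 2) \<le> 1 * (\<beta> / 2)"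
        by (rule mult_mono) (use \<alpha> small \<beta>0 wpos[of v] in \<open>auto simp: w_def\<close>)
      also have "\<dots> \<le> \<beta> * s" using s \<beta>16 \<beta>0 by simp
      finally have "\<alpha> * (w v / 2) \<le> \<beta> * s" .
      moreover have "(1 - 1 / real r - 2 * \<beta>) * s = \<alpha> * s - \<beta> * s"
        by (simp add: \<alpha>_def algebra_simps)
      moreover have "\<alpha> * s - \<alpha> * (w v / 2) \<le> deg w A S v"
        using d[OF that] by (simp add: s_def right_diff_distrib)
      ultimately show ?thesis by linarith
    qed
    have "\<exists>P. multipartite A S (Suc (r - 1)) (8 * q) P"
    proof (rule md[OF A(1) fS])
      show "0 < sum w S" using s \<beta>16 by (simp add: s_def)
      have "1 / real n \<le> \<eta>1 * (1 / 2)" using small by simp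
      also have "\<dots> \<le> \<eta>1 * s" using s \<beta>16 \<eta>1 by (intro mult_left_mono) auto
      finally show "\<forall>v\<in>S. 0 \<le> w v \<and> w v \<le> \<eta>1 * sum w S" by (simp add: w_def s_def)
      show "\<forall>v\<in>S. (real (r - 1) - 1 + 1 / (2 * real r)) * sum w S \<le> real (r - 1) * deg w A S v"
      proof
        fix v assume "v \<in> S"
        have "(real r - 1) * (2 * \<beta>) \<le> 1 / (2 * real r)"
        proof -
          have "(real r - 1) * (2 * \<beta>) \<le> real r * (2 * \<beta>)" using \<beta>0 by simp
          also have "\<dots> \<le> 1 / (2 * real r)"
            using \<beta>r r by (simp add: field_simps power2_eq_square)
          finally show ?thesis .
        qed
        moreover have "(real r - 1) * (1 - 1 / real r - 2 * \<beta>)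
            = real r - 2 + 1 / real r - (real r - 1) * (2 * \<beta>)"
          using r by (simp add: field_simps)
        ultimately have "real (r - 1) - 1 + 1 / (2 * real r) \<le> real (r - 1) * (1 - 1 / real r - 2 * \<beta>)"
          using r by (simp add: of_nat_diff)
        then have "(real (r - 1) - 1 + 1 / (2 * real r)) * s \<le> real (r - 1) * ((1 - 1 / real r - 2 * \<beta>) * s)"
          using s0 by (simp add: mult_right_mono mult.assoc[symmetric])
        also have "\<dots> \<le> real (r - 1) * deg w A S v"
          by (intro mult_left_mono deg[OF \<open>v \<in> S\<close>]) simp
        finally show "(real (r - 1) - 1 + 1 / (2 * real r)) * sum w S \<le> real (r - 1) * deg w A S v"
          by (simp add: s_def)
      qed
    qed
    then obtain P0 where "multipartite A S r (8 * q) P0" using r by auto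
    then obtain P where P: "multipartite A S r (8 * q) P" "\<And>i. i < r \<Longrightarrow> card (P i) = 8 * q"
      by (rule multipartite_trim) blast
    have dS: "(real r - 1 - 2 * real r * \<beta>) * real (card S) \<le> real r * real (card {v\<in>S. A u v})"
      if "u \<in> S" for u
    proof -
      have "real r * real n * ((1 - 1 / real r - 2 * \<beta>) * s) \<le> real r * real n * deg w A S u"
        by (rule mult_left_mono[OF deg[OF that]]) simp
      moreover have "real r * real n * deg w A S u = real r * real (card {v\<in>S. A u v})"
        using nb by (simp add: w_def deg_const)
      moreover have "real r * real n * ((1 - 1 / real r - 2 * \<beta>) * s)
          = (real r - 1 - 2 * real r * \<beta>) * real (card S)"
        using r by (simp add: cS field_simps)
      ultimately show ?thesis by simp
    qed
    obtain G c where G: "G \<subseteq> S" and c: "\<And>v. c v < r"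
      and SG: "real q * real (card (S - G)) \<le> 8 * real q * (2 * real r * \<beta>) * real (card S)
         + real t * real (card S) + 9 * real q * real (t * 2 ^ (r * (8 * q)))"
      and cls: "\<And>i. i < r \<Longrightarrow> \<nexists>Q. multipartite A {v\<in>G. c v = i} 2 (t * 2 ^ (r * (8 * q)) + 1) Q"
      using typical_classes[OF V S A(1) r q no P dS] by blast
    have "real q * real (card (S - G)) \<le> 8 * real q * (2 * real r * \<beta>) * real n
         + \<beta> * real q * real n + 9 * real q * (\<beta> * real n)"
    proof -
      have "8 * real q * (2 * real r * \<beta>) * real (card S) \<le> 8 * real q * (2 * real r * \<beta>) * real n"
        using \<open>card S \<le> n\<close> \<beta>0 by (intro mult_left_mono) auto
      moreover have "real t * real (card S) \<le> \<beta> * real q * real n"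
        using \<open>card S \<le> n\<close> \<beta>0 tq by (intro mult_mono) auto
      moreover have "9 * real q * real (t * 2 ^ (r * (8 * q))) \<le> 9 * real q * (\<beta> * real n)"
        unfolding M_def[symmetric] using Mn by (intro mult_left_mono) auto
      ultimately show ?thesis using SG by linarith
    qed
    also have "\<dots> = real q * ((16 * real r + 10) * \<beta> * real n)" by (simp add: algebra_simps)
    finally have SG: "real (card (S - G)) \<le> (16 * real r + 10) * \<beta> * real n" using q by simp
    \<comment> \<open>Exceptional vertices: at most \<open>\<beta> * n\<close> lie outside the core,
      and at most \<open>(16 * r + 10) * \<beta> * n\<close> of the core are not typical.\<close>
    define R where "R = V - G"
    have fR: "finite R" using V by (simp add: R_def)
    have "R = (V - S) \<union> (S - G)" using S G by (auto simp: R_def)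
    then have "card R \<le> card (V - S) + card (S - G)" by (simp add: card_Un_le)
    moreover have "real (card (V - S)) = real n - s * real n"
      using S fS \<open>card S \<le> n\<close> cS by (simp add: card_Diff_subset n_def of_nat_diff)
    moreover have "(1 - \<beta>) * real n \<le> s * real n" using s by (intro mult_right_mono) auto
    ultimately have R: "real (card R) \<le> (16 * real r + 11) * \<beta> * real n"
      using SG by (simp add: algebra_simps)
    let ?U = "\<lambda>i. {v\<in>G. c v = i}"
    have inner: "real (card {(u, v) \<in> ?U i \<times> ?U i. A u v}) \<le> \<kappa> / (2 * real r) * (real n)\<^sup>2" if "i < r" for i
    proof (rule ccontr)
      assume neg: "\<not> ?thesis"
      have UV: "?U i \<subseteq> V" using G S by blast
      then have fU: "finite (?U i)" using V finite_subset by blast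
      have "sum w (?U i) \<le> 1"
        using sum_mono2[OF V UV, of w] wpos sV by (simp add: less_imp_le)
      moreover have "(1 - 1 / real 1) * (sum w (?U i))\<^sup>2 + \<kappa> / (2 * real r) \<le> edge_weight w A (?U i)"
        using neg nb unfolding ew[OF fU] by (simp add: pos_le_divide_eq)
      moreover have "\<forall>v\<in>?U i. 0 < w v \<and> w v \<le> \<eta>2" using wpos small by (simp add: w_def)
      ultimately have "\<exists>P. multipartite A (?U i) (Suc 1) (M + 1) P"
        using es2[OF A fU, of w] by blast
      then show False using cls[OF that] unfolding M_def by (simp add: numeral_2_eq_2)
    qed
    \<comment> \<open>An adjacent pair of one colour lies inside a typical class or meets
      \<open>R\<close>; each kind uses half of \<open>\<kappa>\<close>.\<close>
    have "{(u, v) \<in> V \<times> V. A u v \<and> c u = c v} \<subseteq>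
        (\<Union>i<r. {(u, v) \<in> ?U i \<times> ?U i. A u v}) \<union> (R \<times> V \<union> V \<times> R)" (is "?L \<subseteq> ?I \<union> ?O")
      using c by (auto simp: R_def)
    moreover have finI: "finite ?I"
    proof (intro finite_UN_I)
      fix i
      have "{(u, v) \<in> ?U i \<times> ?U i. A u v} \<subseteq> V \<times> V" using G S by blast
      then show "finite {(u, v) \<in> ?U i \<times> ?U i. A u v}" using V by (meson finite_SigmaI finite_subset)
    qed simp
    moreover have "finite ?O" using V fR by simp
    ultimately have "card ?L \<le> card ?I + card ?O"
      by (meson card_Un_le card_mono finite_UnI order_trans)
    also have "card ?I \<le> (\<Sum>i<r. card {(u, v) \<in> ?U i \<times> ?U i. A u v})"
      by (rule card_UN_le) simp
    also have "card ?O \<le> card R * n + n * card R"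
      using card_Un_le[of "R \<times> V" "V \<times> R"] by (simp add: card_cartesian_product n_def)
    finally have "real (card ?L) \<le> (\<Sum>i<r. real (card {(u, v) \<in> ?U i \<times> ?U i. A u v})) + 2 * real (card R) * real n"
      by (simp add: mult_ac of_nat_le_iff[symmetric, where 'a=real] del: of_nat_le_iff)
    also have "\<dots> \<le> (\<Sum>i<r. \<kappa> / (2 * real r) * (real n)\<^sup>2) + 2 * ((16 * real r + 11) * \<beta> * real n) * real n"
      using R inner by (intro add_mono sum_mono mult_right_mono mult_left_mono) auto
    also have "\<dots> = (\<kappa> / 2 + 2 * ((16 * real r + 11) * \<beta>)) * (real n)\<^sup>2"
      using r by (simp add: power2_eq_square algebra_simps)
    also have "\<dots> \<le> \<kappa> * (real n)\<^sup>2" using \<beta>\<kappa> by (intro mult_right_mono) auto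
    finally show "\<exists>c. (\<forall>v. c v < r) \<and>
        real (card {(u, v) \<in> V \<times> V. A u v \<and> c u = c v}) \<le> \<kappa> * (real (card V))\<^sup>2"
      using c unfolding n_def by blast
  qed
qed

subsection \<open>Edit distance to the Turan graph\<close>

lemma card_pairs_same_class:
  fixes c :: "'a \<Rightarrow> nat"
  assumes "finite V" "\<And>v. v \<in> V \<Longrightarrow> c v < r"
  shows "card {(u, v) \<in> V \<times> V. c u = c v} = (\<Sum>i<r. (card {v\<in>V. c v = i})\<^sup>2)"
proof -
  have "{(u, v) \<in> V \<times> V. c u = c v} = (\<Union>i<r. {v\<in>V. c v = i} \<times> {v\<in>V. c v = i})"
    using assms(2) by auto
  also have "card \<dots> = (\<Sum>i<r. card ({v\<in>V. c v = i} \<times> {v\<in>V. c v = i}))"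
    by (rule card_UN_disjoint) (use assms(1) in auto)
  finally show ?thesis by (simp add: card_cartesian_product power2_eq_square)
qed

lemma sum_card_classes:
  fixes c :: "'a \<Rightarrow> nat"
  assumes "finite V" "\<And>v. v \<in> V \<Longrightarrow> c v < r"
  shows "(\<Sum>i<r. card {v\<in>V. c v = i}) = card V"
proof -
  have "card (\<Union>i<r. {v\<in>V. c v = i}) = (\<Sum>i<r. card {v\<in>V. c v = i})"
    by (rule card_UN_disjoint) (use assms(1) in auto)
  moreover have "(\<Union>i<r. {v\<in>V. c v = i}) = V" using assms(2) by auto
  ultimately show ?thesis by simp
qed

text \<open>Counting all ordered pairs, adjacent, missing cross and same-class pairs together exceed
  \<open>n^2\<close> by exactly the inner adjacent ones. The same-class pairs number
  \<open>n^2 / r\<close> plus the sum of squared deviations, so one budget pays for both missing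
  cross pairs and imbalance.\<close>

lemma dense_partition_balanced:
  fixes c :: "'a \<Rightarrow> nat" and \<delta> \<kappa> :: real
  assumes V: "finite V" "\<And>v. v \<in> V \<Longrightarrow> c v < r" and r: "r \<ge> 1"
    and e: "(1 - 1 / real r - \<delta>) * (real (card V))\<^sup>2 \<le> real (card {(u, v) \<in> V \<times> V. A u v})"
    and i: "real (card {(u, v) \<in> V \<times> V. A u v \<and> c u = c v}) \<le> \<kappa> * (real (card V))\<^sup>2"
  shows "real (card {(u, v) \<in> V \<times> V. \<not> A u v \<and> c u \<noteq> c v})
      + (\<Sum>i<r. (real (card {v\<in>V. c v = i}) - real (card V) / real r)\<^sup>2) \<le> (\<delta> + \<kappa>) * (real (card V))\<^sup>2"
proof -
  let ?n = "real (card V)"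
  let ?E = "{(u, v) \<in> V \<times> V. A u v}" and ?I = "{(u, v) \<in> V \<times> V. A u v \<and> c u = c v}"
    and ?N = "{(u, v) \<in> V \<times> V. \<not> A u v \<and> c u \<noteq> c v}" and ?D = "{(u, v) \<in> V \<times> V. c u = c v}"
  have fin: "finite (V \<times> V)" using V by simp
  have f: "finite ?E" "finite ?I" "finite ?N" "finite ?D"
    by (rule finite_subset[OF _ fin], blast)+
  have "card ?E + card (?N \<union> ?D) = card (?E \<union> (?N \<union> ?D)) + card (?E \<inter> (?N \<union> ?D))"
    using f by (intro card_Un_Int) auto
  moreover have "?E \<union> (?N \<union> ?D) = V \<times> V" by auto
  moreover have "?E \<inter> (?N \<union> ?D) = ?I" by auto
  moreover have "card (?N \<union> ?D) = card ?N + card ?D" using f by (intro card_Un_disjoint) auto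
  ultimately have "card ?E + (card ?N + card ?D) = card V * card V + card ?I"
    by (simp add: card_cartesian_product)
  then have *: "real (card ?E) + (real (card ?N) + real (card ?D)) = ?n\<^sup>2 + real (card ?I)"
    by (simp only: of_nat_add[symmetric] of_nat_mult[symmetric] power2_eq_square)
  have "(\<Sum>i<r. (real (card {v\<in>V. c v = i}) - ?n / real r)\<^sup>2)
      = (\<Sum>i<r. (real (card {v\<in>V. c v = i}))\<^sup>2) - 2 * (?n / real r) * (\<Sum>i<r. real (card {v\<in>V. c v = i})) + real r * (?n / real r)\<^sup>2"
    by (simp add: power2_diff sum.distrib sum_subtractf sum_distrib_left mult_ac)
  also have "(\<Sum>i<r. real (card {v\<in>V. c v = i})) = ?n"
    using arg_cong[where f = real, OF sum_card_classes[OF V]] by simp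
  also have "(\<Sum>i<r. (real (card {v\<in>V. c v = i}))\<^sup>2) = real (card ?D)"
    using arg_cong[where f = real, OF card_pairs_same_class[OF V]] by simp
  also have "real (card ?D) - 2 * (?n / real r) * ?n + real r * (?n / real r)\<^sup>2 = real (card ?D) - ?n\<^sup>2 / real r"
    using r by (simp add: power2_eq_square field_simps)
  finally have "(\<Sum>i<r. (real (card {v\<in>V. c v = i}) - ?n / real r)\<^sup>2) = real (card ?D) - ?n\<^sup>2 / real r" .
  then show ?thesis using * e i by (simp add: algebra_simps)
qed

text \<open>Within each index, pair off as many elements as the smaller of the two classes has, and
  match the rest arbitrarily. Only the surplus of an \<open>a\<close>-class over the
  \<open>b\<close>-class is misplaced; the subtraction of naturals truncates at 0 as wanted.\<close>

lemma class_matching: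
  fixes a b :: "'a \<Rightarrow> nat"
  assumes V: "finite V" and a: "\<And>x. x \<in> V \<Longrightarrow> a x < r"
  obtains \<sigma> where "bij_betw \<sigma> V V"
    "card {x\<in>V. b (\<sigma> x) \<noteq> a x} \<le> (\<Sum>i<r. card {x\<in>V. a x = i} - card {x\<in>V. b x = i})"
proof -
  let ?A = "\<lambda>i. {x\<in>V. a x = i}" and ?B = "\<lambda>i. {x\<in>V. b x = i}"
  have "\<exists>A' B' h. A' \<subseteq> ?A i \<and> B' \<subseteq> ?B i \<and> card A' = min (card (?A i)) (card (?B i)) \<and> bij_betw h A' B'" for i
  proof -
    obtain A' where A': "A' \<subseteq> ?A i" "card A' = min (card (?A i)) (card (?B i))" "finite A'"
      by (rule obtain_subset_with_card_n[OF min.cobounded1])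
    obtain B' where B': "B' \<subseteq> ?B i" "card B' = min (card (?A i)) (card (?B i))" "finite B'"
      by (rule obtain_subset_with_card_n[OF min.cobounded2])
    obtain h where "bij_betw h A' B'" using finite_same_card_bij[OF A'(3) B'(3)] A' B' by auto
    then show ?thesis using A' B' by blast
  qed
  then have "\<forall>i. \<exists>A' B' h. A' \<subseteq> ?A i \<and> B' \<subseteq> ?B i \<and> card A' = min (card (?A i)) (card (?B i)) \<and> bij_betw h A' B'"
    by (rule allI)
  then obtain A' B' h where sel: "\<forall>i. A' i \<subseteq> ?A i \<and> B' i \<subseteq> ?B i \<and>
      card (A' i) = min (card (?A i)) (card (?B i)) \<and> bij_betw (h i) (A' i) (B' i)"
    unfolding choice_iff by (elim exE)
  have A'sub: "A' i \<subseteq> ?A i" and B'sub: "B' i \<subseteq> ?B i"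
    and cA: "card (A' i) = min (card (?A i)) (card (?B i))"
    and h: "bij_betw (h i) (A' i) (B' i)" for i
    using sel[THEN spec, of i] by - (elim conjE, assumption)+
  define X where "X = (\<Union>i<r. A' i)"
  define Y where "Y = (\<Union>i<r. B' i)"
  have XV: "X \<subseteq> V" "Y \<subseteq> V" using A'sub B'sub by (auto simp: X_def Y_def)
  have fX: "finite X" "finite Y" using XV V finite_subset by blast+
  have aX: "x \<in> A' (a x) \<and> a x < r" if "x \<in> X" for x using that A'sub unfolding X_def by blast
  have bh: "b (h (a x) x) = a x" if "x \<in> X" for x
    using bij_betwE[OF h] aX[OF that] B'sub by blast
  have bij: "bij_betw (\<lambda>x. h (a x) x) X Y"
  proof (rule bij_betw_imageI)
    show "inj_on (\<lambda>x. h (a x) x) X"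
    proof (rule inj_onI)
      fix x y assume xy: "x \<in> X" "y \<in> X" "h (a x) x = h (a y) y"
      then have "a x = a y" using bh by metis
      then show "x = y" using xy aX h by (metis bij_betw_def inj_onD)
    qed
    show "(\<lambda>x. h (a x) x) ` X = Y"
    proof
      show "(\<lambda>x. h (a x) x) ` X \<subseteq> Y" using aX bij_betwE[OF h] by (fastforce simp: Y_def)
      show "Y \<subseteq> (\<lambda>x. h (a x) x) ` X"
      proof
        fix y assume "y \<in> Y"
        then obtain i where i: "i < r" "y \<in> B' i" by (auto simp: Y_def)
        then obtain x where x: "x \<in> A' i" "y = h i x" using h[of i] by (auto simp: bij_betw_def)
        then have "a x = i" using A'sub by blast
        then show "y \<in> (\<lambda>x. h (a x) x) ` X" using x i by (auto simp: X_def)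
      qed
    qed
  qed
  have "card (V - X) = card (V - Y)"
    using bij_betw_same_card[OF bij] XV fX by (simp add: card_Diff_subset)
  then obtain g where g: "bij_betw g (V - X) (V - Y)"
    using finite_same_card_bij[of "V - X" "V - Y"] V by auto
  define \<sigma> where "\<sigma> x = (if x \<in> X then h (a x) x else g x)" for x
  have "bij_betw \<sigma> (X \<union> (V - X)) (Y \<union> (V - Y))"
  proof (rule bij_betw_combine)
    show "bij_betw \<sigma> X Y" using bij by (rule iffD1[OF bij_betw_cong, rotated]) (simp add: \<sigma>_def)
    show "bij_betw \<sigma> (V - X) (V - Y)" using g by (rule iffD1[OF bij_betw_cong, rotated]) (simp add: \<sigma>_def)
  qed auto
  moreover have "X \<union> (V - X) = V" "Y \<union> (V - Y) = V" using XV by auto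
  ultimately have \<sigma>: "bij_betw \<sigma> V V" by simp
  have "{x\<in>V. b (\<sigma> x) \<noteq> a x} \<subseteq> V - X" using bh by (auto simp: \<sigma>_def)
  also have "V - X \<subseteq> (\<Union>i<r. ?A i - A' i)" using a A'sub by (auto simp: X_def)
  finally have "card {x\<in>V. b (\<sigma> x) \<noteq> a x} \<le> card (\<Union>i<r. ?A i - A' i)"
    using V by (intro card_mono) auto
  also have "\<dots> \<le> (\<Sum>i<r. card (?A i - A' i))" by (rule card_UN_le) simp
  also have "\<dots> = (\<Sum>i<r. card (?A i) - card (?B i))"
  proof (rule sum.cong[OF refl])
    fix i
    have "finite (A' i)" by (rule finite_subset[OF A'sub]) (use V in simp)
    then show "card (?A i - A' i) = card (?A i) - card (?B i)"
      using A'sub[of i] cA[of i] by (simp add: card_Diff_subset min_def)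
  qed
  finally show thesis using that \<sigma> by blast
qed

text \<open>Division by \<open>r\<close> is injective on a residue class and takes values in
  \<open>{..n div r}\<close>.\<close>

lemma card_mod_class_le:
  assumes "r > 0"
  shows "real (card {x\<in>{..<n}. x mod r = i}) \<le> real n / real r + 1"
proof -
  have "inj_on (\<lambda>x. x div r) {x\<in>{..<n}. x mod r = i}"
    by (rule inj_onI) (metis (mono_tags, lifting) div_mult_mod_eq mem_Collect_eq)
  moreover have "(\<lambda>x. x div r) ` {x\<in>{..<n}. x mod r = i} \<subseteq> {..n div r}"
    by (auto intro: div_le_mono)
  ultimately have "card {x\<in>{..<n}. x mod r = i} \<le> n div r + 1"
    using card_inj_on_le[of _ _ "{..n div r}"] by fastforce
  then have "real (card {x\<in>{..<n}. x mod r = i}) \<le> real (n div r) + 1"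
    by (metis of_nat_1 of_nat_add of_nat_mono)
  also have "real (n div r) \<le> real n / real r" by (rule of_nat_div_le_of_nat)
  finally show ?thesis by simp
qed

lemma edit_distance_le:
  assumes "bij_betw \<sigma> {..<n} {..<n}"
  shows "edit_distance n E1 E2 \<le> card ((E1 - (\<lambda>e. \<sigma> ` e) ` E2) \<union> ((\<lambda>e. \<sigma> ` e) ` E2 - E1))"
  unfolding edit_distance_def by (rule Least_le) (use assms in blast)

text \<open>Any relabelling bounds the distance from above. Aligning residue classes with colour
  classes, each disputed edge has a misplaced endpoint, is an edge inside a class, or is a missing
  pair between two classes.\<close>

lemma edit_distance_turan_le:
  fixes \<delta> \<kappa> \<theta> :: real
  assumes E: "simple_graph n E" and r: "r \<ge> 1" and c: "\<And>v. c v < r"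
    and e: "(1 - 1 / real r - \<delta>) * (real n)\<^sup>2 \<le> real (card {(u, v) \<in> {..<n} \<times> {..<n}. {u, v} \<in> E})"
    and i: "real (card {(u, v) \<in> {..<n} \<times> {..<n}. {u, v} \<in> E \<and> c u = c v}) \<le> \<kappa> * (real n)\<^sup>2"
    and \<theta>: "\<theta> \<ge> 0" "\<delta> + \<kappa> \<le> \<theta>\<^sup>2"
  shows "real (edit_distance n E (turan_graph n r))
    \<le> real r * (\<theta> * real n + 1) * real n + (\<delta> + 2 * \<kappa>) * (real n)\<^sup>2"
proof -
  let ?V = "{..<n}"
  let ?I = "{(u, v) \<in> ?V \<times> ?V. {u, v} \<in> E \<and> c u = c v}"
  let ?N = "{(u, v) \<in> ?V \<times> ?V. {u, v} \<notin> E \<and> c u \<noteq> c v}"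
  have bal: "real (card ?N) + (\<Sum>i<r. (real (card {v\<in>?V. c v = i}) - real n / real r)\<^sup>2) \<le> (\<delta> + \<kappa>) * (real n)\<^sup>2"
    using dense_partition_balanced[of ?V c r \<delta> "\<lambda>u v. {u, v} \<in> E" \<kappa>] c r e i by simp
  have N: "real (card ?N) \<le> (\<delta> + \<kappa>) * (real n)\<^sup>2"
    using bal sum_nonneg[of "{..<r}" "\<lambda>i. (real (card {v\<in>?V. c v = i}) - real n / real r)\<^sup>2"] by simp
  have size: "real n / real r - real (card {v\<in>?V. c v = i}) \<le> \<theta> * real n" if "i < r" for i
  proof -
    have "(real (card {v\<in>?V. c v = i}) - real n / real r)\<^sup>2
        \<le> (\<Sum>i<r. (real (card {v\<in>?V. c v = i}) - real n / real r)\<^sup>2)"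
      by (rule member_le_sum) (use that in auto)
    also have "\<dots> \<le> (\<delta> + \<kappa>) * (real n)\<^sup>2" using bal by simp
    also have "\<dots> \<le> (\<theta> * real n)\<^sup>2"
      unfolding power_mult_distrib using \<theta>(2) by (rule mult_right_mono) simp
    finally have "\<bar>real (card {v\<in>?V. c v = i}) - real n / real r\<bar> \<le> \<theta> * real n"
      using \<theta>(1) by (simp add: abs_le_square_iff[symmetric])
    then show ?thesis by simp
  qed
  obtain \<sigma> where \<sigma>: "bij_betw \<sigma> ?V ?V"
    and mis: "card {x\<in>?V. c (\<sigma> x) \<noteq> x mod r} \<le> (\<Sum>i<r. card {x\<in>?V. x mod r = i} - card {x\<in>?V. c x = i})"
    using class_matching[of ?V "\<lambda>x. x mod r" r c] r by auto
  \<comment> \<open>The misplaced vertices, named by their images since the comparison takes place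
    on the side of \<open>E\<close>.\<close>
  define B where "B = \<sigma> ` {x\<in>?V. c (\<sigma> x) \<noteq> x mod r}"
  have "real (card B) \<le> real (card {x\<in>?V. c (\<sigma> x) \<noteq> x mod r})"
    unfolding B_def by (intro of_nat_mono card_image_le) simp
  also have "\<dots> \<le> (\<Sum>i<r. real (card {x\<in>?V. x mod r = i} - card {x\<in>?V. c x = i}))"
    using mis by (simp only: of_nat_sum[symmetric] of_nat_le_iff)
  also have "\<dots> \<le> (\<Sum>i<r. \<theta> * real n + 1)"
  proof (rule sum_mono)
    fix i assume "i \<in> {..<r}"
    then have "real n / real r - real (card {v\<in>?V. c v = i}) \<le> \<theta> * real n" using size by simp
    moreover have "real (card {x\<in>?V. x mod r = i}) \<le> real n / real r + 1"
      using r by (intro card_mod_class_le) simp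
    moreover have "0 \<le> \<theta> * real n" using \<theta> by simp
    ultimately show "real (card {x\<in>?V. x mod r = i} - card {x\<in>?V. c x = i}) \<le> \<theta> * real n + 1"
      by (simp add: of_nat_diff_if)
  qed
  finally have B: "real (card B) \<le> real r * (\<theta> * real n + 1)" by simp
  have fB: "finite B" by (simp add: B_def)
  let ?T = "(\<lambda>e. \<sigma> ` e) ` turan_graph n r"
  let ?h = "\<lambda>(u, v). {u, v}"
  \<comment> \<open>The condition \<open>neq\<close> covers both kinds of edit at once: an edge of
    \<open>E\<close> within a residue class, or a Turan edge absent from \<open>E\<close>.\<close>
  have in_h: "{\<sigma> x, \<sigma> y} \<in> ?h ` (B \<times> ?V \<union> ?I \<union> ?N)"
    if xy: "x < n" "y < n" and neq: "({\<sigma> x, \<sigma> y} \<in> E) = (x mod r = y mod r)" for x y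
  proof -
    have s: "\<sigma> x < n" "\<sigma> y < n" using \<sigma> xy by (auto simp: bij_betw_def)
    show ?thesis
    proof (cases "\<sigma> x \<in> B \<or> \<sigma> y \<in> B")
      case True
      then have "(\<sigma> x, \<sigma> y) \<in> B \<times> ?V \<or> (\<sigma> y, \<sigma> x) \<in> B \<times> ?V" using s by auto
      then show ?thesis
      proof
        assume "(\<sigma> x, \<sigma> y) \<in> B \<times> ?V"
        then show ?thesis by (intro image_eqI[of _ _ "(\<sigma> x, \<sigma> y)"]) auto
      next
        assume "(\<sigma> y, \<sigma> x) \<in> B \<times> ?V"
        then show ?thesis by (intro image_eqI[of _ _ "(\<sigma> y, \<sigma> x)"]) auto
      qed
    next
      case False
      then have "c (\<sigma> x) = x mod r" "c (\<sigma> y) = y mod r" using xy unfolding B_def by blast+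
      then have "(\<sigma> x, \<sigma> y) \<in> ?I \<union> ?N" using neq s by auto
      then show ?thesis by (intro image_eqI[of _ _ "(\<sigma> x, \<sigma> y)"]) auto
    qed
  qed
  have "(E - ?T) \<union> (?T - E) \<subseteq> ?h ` (B \<times> ?V \<union> ?I \<union> ?N)"
  proof
    fix e assume "e \<in> (E - ?T) \<union> (?T - E)"
    then show "e \<in> ?h ` (B \<times> ?V \<union> ?I \<union> ?N)"
    proof
      assume e: "e \<in> E - ?T"
      then have "\<exists>i j. i < n \<and> j < n \<and> i \<noteq> j \<and> e = {i, j}" using E by (simp add: simple_graph_def)
      then obtain u v where uv: "u < n" "v < n" "e = {u, v}" by (elim exE conjE)
      then obtain x y where xy: "x < n" "y < n" "u = \<sigma> x" "v = \<sigma> y"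
        using \<sigma> unfolding bij_betw_def by (metis (no_types, lifting) imageE lessThan_iff)
      have "x mod r = y mod r"
      proof (rule ccontr)
        assume "x mod r \<noteq> y mod r"
        then have "{x, y} \<in> turan_graph n r" using xy unfolding turan_graph_def by blast
        then have "\<sigma> ` {x, y} \<in> ?T" by blast
        then show False using e uv xy by simp
      qed
      then show ?thesis using in_h[OF xy(1,2)] e uv xy by simp
    next
      assume e: "e \<in> ?T - E"
      then obtain x y where "x < n" "y < n" "x mod r \<noteq> y mod r" "e = {\<sigma> x, \<sigma> y}"
        unfolding turan_graph_def by auto
      then show ?thesis using in_h[of x y] e by simp
    qed
  qed
  moreover have fin: "finite (B \<times> ?V \<union> ?I \<union> ?N)"
    using fB by (auto intro: finite_subset[of _ "?V \<times> ?V"])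
  ultimately have "card ((E - ?T) \<union> (?T - E)) \<le> card (B \<times> ?V \<union> ?I \<union> ?N)"
    by (meson card_image_le card_mono finite_imageI order_trans)
  also have "\<dots> \<le> card (B \<times> ?V) + card ?I + card ?N"
    by (meson add_le_mono1 card_Un_le order_trans)
  also have "card (B \<times> ?V) = card B * n" by (simp add: card_cartesian_product)
  finally have "edit_distance n E (turan_graph n r) \<le> card B * n + card ?I + card ?N"
    using edit_distance_le[OF \<sigma>, of E "turan_graph n r"] by simp
  then have "real (edit_distance n E (turan_graph n r)) \<le> real (card B * n + card ?I + card ?N)"
    by (rule of_nat_mono)
  also have "\<dots> = real (card B) * real n + real (card ?I) + real (card ?N)" by simp
  also have "\<dots> \<le> real r * (\<theta> * real n + 1) * real n + \<kappa> * (real n)\<^sup>2 + (\<delta> + \<kappa>) * (real n)\<^sup>2"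
    using B i N by (intro add_mono mult_right_mono) auto
  finally show ?thesis by (simp add: algebra_simps)
qed

subsection \<open>From the spectral radius to the number of edges\<close>

lemma simple_graph_edgeD:
  assumes "simple_graph n E" "{i, j} \<in> E"
  shows "i < n" "j < n" "i \<noteq> j"
proof -
  obtain a b where "a < n" "b < n" "a \<noteq> b" "{i, j} = {a, b}"
    using assms unfolding simple_graph_def by meson
  then show "i < n" "j < n" "i \<noteq> j" by (auto simp: doubleton_eq_iff)
qed

lemma simple_graph_adjacency:
  assumes "simple_graph n E"
  shows "symp (\<lambda>u v. {u, v} \<in> E)" "irreflp (\<lambda>u v. {u, v} \<in> E)"
  using simple_graph_edgeD(3)[OF assms] by (auto simp: insert_commute intro!: sympI irreflpI)

lemma colorable_chromatic_number:
  assumes "simple_graph n E"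
  shows "colorable n E (chromatic_number n E)"
  unfolding chromatic_number_def
proof (rule LeastI)
  show "colorable n E n"
    unfolding colorable_def using simple_graph_edgeD(3)[OF assms] by (intro exI[of _ id]) auto
qed

text \<open>Each colour class is injected into its own part, which has room for all \<open>m\<close>
  vertices. Vertices of different colours get adjacent, hence distinct, images, so the combined map
  is injective.\<close>

lemma contains_subgraph_of_multipartite:
  assumes F: "simple_graph m EF" and G: "simple_graph n EG" and c: "colorable m EF k"
    and P: "multipartite (\<lambda>u v. {u, v} \<in> EG) {..<n} k m P"
  shows "contains_subgraph n EG m EF"
proof -
  obtain c where c: "\<And>i. i < m \<Longrightarrow> c i < k" "\<And>i j. {i, j} \<in> EF \<Longrightarrow> c i \<noteq> c j"
    using c unfolding colorable_def by blast
  have Pi: "P i \<subseteq> {..<n}" "m \<le> card (P i)" if "i < k" for i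
    using P that unfolding multipartite_def by auto
  have PA: "{u, v} \<in> EG" if "i < k" "j < k" "i \<noteq> j" "u \<in> P i" "v \<in> P j" for i j u v
    using P that unfolding multipartite_def by blast
  have "\<exists>g. g ` {..<m} \<subseteq> P i \<and> inj_on g {..<m}" if "i < k" for i
  proof (rule card_le_inj)
    show "finite (P i)" using Pi(1)[OF that] finite_subset by blast
  qed (use Pi(2)[OF that] in auto)
  then obtain g where g: "\<And>i. i < k \<Longrightarrow> inj_on (g i) {..<m}" "\<And>i. i < k \<Longrightarrow> g i ` {..<m} \<subseteq> P i"
    by metis
  define f where "f x = g (c x) x" for x
  have f: "f x \<in> P (c x)" if "x < m" for x using g(2)[OF c(1)[OF that]] that by (auto simp: f_def)
  have "inj_on f {..<m}"
  proof (rule inj_onI)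
    fix x y assume xy: "x \<in> {..<m}" "y \<in> {..<m}" "f x = f y"
    have "c x = c y"
    proof (rule ccontr)
      assume "c x \<noteq> c y"
      then have "{f x, f y} \<in> EG" using PA c f xy by blast
      then show False using simple_graph_edgeD(3)[OF G] xy by blast
    qed
    then show "x = y" using g(1)[OF c(1)] xy by (auto simp: f_def dest: inj_onD)
  qed
  moreover have "f ` {..<m} \<subseteq> {..<n}" using f Pi(1) c(1) by blast
  moreover have "{f i, f j} \<in> EG" if ij: "{i, j} \<in> EF" for i j
    using simple_graph_edgeD[OF F ij] c(1) c(2)[OF ij] f by (intro PA[of "c i" "c j"]) auto
  ultimately show ?thesis unfolding contains_subgraph_def by blast
qed

text \<open>Each edge \<open>{i, j}\<close> has exactly the two preimages \<open>(i, j)\<close> and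
  \<open>(j, i)\<close>; this turns the form over edges into one over ordered pairs, as in
  \<open>edge_weight\<close>.\<close>

lemma sum_edges_eq_sum_pairs:
  fixes x :: "nat \<Rightarrow> real"
  assumes "simple_graph n E"
  shows "2 * (\<Sum>e\<in>E. \<Prod>v\<in>e. x v) = (\<Sum>(u, v)\<in>{(u, v) \<in> {..<n} \<times> {..<n}. {u, v} \<in> E}. x u * x v)"
proof -
  let ?D = "{(u, v) \<in> {..<n} \<times> {..<n}. {u, v} \<in> E}"
  let ?h = "\<lambda>(u, v). {u, v}"
  have fin: "finite ?D" by (rule finite_subset[of _ "{..<n} \<times> {..<n}"]) auto
  have img: "?h ` ?D = E"
  proof
    show "E \<subseteq> ?h ` ?D"
    proof
      fix e assume e: "e \<in> E"
      then have "\<exists>i j. i < n \<and> j < n \<and> i \<noteq> j \<and> e = {i, j}" using assms by (simp add: simple_graph_def)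
      then obtain i j where "i < n" "j < n" "e = {i, j}" by (elim exE conjE)
      then show "e \<in> ?h ` ?D" using e by (intro image_eqI[of _ _ "(i, j)"]) auto
    qed
  qed auto
  have "(\<Sum>d\<in>?D. case d of (u, v) \<Rightarrow> x u * x v)
      = (\<Sum>e\<in>E. \<Sum>d\<in>{d\<in>?D. ?h d = e}. case d of (u, v) \<Rightarrow> x u * x v)"
    using sum.image_gen[OF fin, of "\<lambda>(u, v). x u * x v" ?h] unfolding img .
  also have "\<dots> = (\<Sum>e\<in>E. 2 * (\<Prod>v\<in>e. x v))"
  proof (rule sum.cong[OF refl])
    fix e assume e: "e \<in> E"
    then have "\<exists>i j. i < n \<and> j < n \<and> i \<noteq> j \<and> e = {i, j}" using assms by (simp add: simple_graph_def)
    then obtain i j where ij: "i < n" "j < n" "i \<noteq> j" "e = {i, j}" by (elim exE conjE)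
    have "{d\<in>?D. ?h d = e} = {(i, j), (j, i)}"
      using ij e by (auto simp: doubleton_eq_iff insert_commute)
    then show "(\<Sum>d\<in>{d\<in>?D. ?h d = e}. case d of (u, v) \<Rightarrow> x u * x v) = 2 * (\<Prod>v\<in>e. x v)"
      using ij by simp
  qed
  finally show ?thesis by (simp add: sum_distrib_left)
qed

text \<open>A vector strictly above a level below the supremum is enough, so no maximizer has to be
  produced; the unit vector at vertex 0 shows that there are admissible vectors.\<close>

lemma p_spectral_radius_witness:
  assumes "n > 0" "L < p_spectral_radius n E p" "p > 1"
  obtains x :: "nat \<Rightarrow> real" where "(\<Sum>i<n. \<bar>x i\<bar> powr p) = 1" "L < 2 * (\<Sum>e\<in>E. \<Prod>v\<in>e. x v)"
proof -
  let ?X = "{2 * (\<Sum>e\<in>E. \<Prod>v\<in>e. x v) | x :: nat \<Rightarrow> real. (\<Sum>i<n. \<bar>x i\<bar> powr p) = 1}"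
  have "(\<Sum>i<n. \<bar>if i = 0 then 1 else 0 :: real\<bar> powr p) = (\<Sum>i<n. if i = 0 then 1 else 0)"
    by (rule sum.cong) auto
  also have "\<dots> = 1" using assms(1) by simp
  finally have "2 * (\<Sum>e\<in>E. \<Prod>v\<in>e. if v = 0 then 1 else 0) \<in> ?X" by blast
  then have "?X \<noteq> {}" by (rule ex_in_conv[THEN iffD1, OF exI])
  from less_cSupD[OF this assms(2)[unfolded p_spectral_radius_def]]
  obtain y where y: "y \<in> ?X" "L < y" by (elim bexE)
  from y(1) obtain x where "y = 2 * (\<Sum>e\<in>E. \<Prod>v\<in>e. x v)" "(\<Sum>i<n. \<bar>x i\<bar> powr p) = 1"
    by (elim CollectE exE conjE)
  with y(2) show thesis using that by simp
qed

text \<open>Young's inequality for \<open>z * 1\<close> with the conjugate exponents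
  \<open>p\<close> and \<open>p / (p - 1)\<close>.\<close>

lemma le_powr_affine:
  fixes z p :: real
  assumes "p > 1" "z \<ge> 0"
  shows "z \<le> z powr p / p + (1 - 1 / p)"
proof -
  have q: "p / (p - 1) > 1" "1 / p + 1 / (p / (p - 1)) = 1" using assms by (auto simp: field_simps)
  have "z * 1 \<le> z powr p / p + 1 powr (p / (p - 1)) / (p / (p - 1))"
    by (rule Youngs_inequality) (use assms q in auto)
  moreover have "1 / (p / (p - 1)) = 1 - 1 / p" using q(2) by linarith
  ultimately show ?thesis by simp
qed

text \<open>Scaling by \<open>n powr (1 / p)\<close> multiplies the form by
  \<open>n powr (2 / p)\<close>, turning \<open>n powr (2 - 2 / p)\<close> into \<open>n^2\<close>;
  absolute values only increase the form.\<close>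

lemma normalized_spectral_witness:
  fixes a p :: real
  assumes G: "simple_graph n E" and n: "n > 0" and p: "p > 1"
    and lam: "a * real n powr (2 - 2 / p) < p_spectral_radius n E p"
  obtains b :: "nat \<Rightarrow> real" where "\<And>u. 0 \<le> b u" "(\<Sum>u<n. b u powr p) = real n"
    "a * (real n)\<^sup>2 < (\<Sum>(u, v)\<in>{(u, v) \<in> {..<n} \<times> {..<n}. {u, v} \<in> E}. b u * b v)"
proof -
  let ?D = "{(u, v) \<in> {..<n} \<times> {..<n}. {u, v} \<in> E}"
  obtain x where x: "(\<Sum>i<n. \<bar>x i\<bar> powr p) = 1" "a * real n powr (2 - 2 / p) < 2 * (\<Sum>e\<in>E. \<Prod>v\<in>e. x v)"
    using p_spectral_radius_witness[OF n lam p] by blast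
  define b where "b u = \<bar>x u\<bar> * real n powr (1 / p)" for u
  have n0: "0 < real n powr (2 / p)" using n by simp
  have sq: "real n powr (1 / p) * real n powr (1 / p) = real n powr (2 / p)"
    unfolding powr_add[symmetric] by simp
  have "a * (real n)\<^sup>2 = a * real n powr (2 - 2 / p) * real n powr (2 / p)"
    using n by (simp add: mult.assoc powr_add[symmetric] powr_numeral)
  also have "\<dots> < 2 * (\<Sum>e\<in>E. \<Prod>v\<in>e. x v) * real n powr (2 / p)"
    using x(2) n0 by (rule mult_strict_right_mono)
  also have "\<dots> = (\<Sum>(u, v)\<in>?D. x u * x v * real n powr (2 / p))"
    unfolding sum_edges_eq_sum_pairs[OF G] by (simp add: sum_distrib_right case_prod_unfold)
  also have "\<dots> \<le> (\<Sum>(u, v)\<in>?D. b u * b v)"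
  proof (rule sum_mono)
    fix d assume "d \<in> ?D"
    obtain u v where d: "d = (u, v)" by (cases d)
    have "x u * x v * real n powr (2 / p) \<le> \<bar>x u * x v\<bar> * real n powr (2 / p)"
      using n0 by (intro mult_right_mono) auto
    also have "\<dots> = b u * b v" by (simp add: b_def abs_mult sq[symmetric] mult_ac)
    finally show "(case d of (u, v) \<Rightarrow> x u * x v * real n powr (2 / p)) \<le> (case d of (u, v) \<Rightarrow> b u * b v)"
      by (simp add: d)
  qed
  finally have "a * (real n)\<^sup>2 < (\<Sum>(u, v)\<in>?D. b u * b v)" .
  moreover have "(\<Sum>u<n. b u powr p) = real n"
  proof -
    have "b u powr p = \<bar>x u\<bar> powr p * real n" for u
      using p n by (simp add: b_def powr_mult powr_powr)
    then show ?thesis using x(1) by (simp add: sum_distrib_right[symmetric])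
  qed
  moreover have "0 \<le> b u" for u by (simp add: b_def)
  ultimately show thesis using that[of b] by blast
qed

text \<open>Vertices with \<open>b u > K\<close> contribute little to the form; on the remaining ones the weights
  \<open>b u powr p / n\<close> are uniformly small, so the weighted Erdos--Stone theorem applies to them.
  The affine bound \<open>le_powr_affine\<close> is tight at \<open>b = 1\<close>, the extremal vector.\<close>

lemma spectral_imp_dense:
  fixes p \<delta>' :: real
  assumes p: "p > 1" and r: "r \<ge> 1" and \<delta>': "\<delta>' > 0"
  shows "\<exists>\<delta>>0. \<exists>n0::nat. \<forall>n\<ge>n0. \<forall>E. simple_graph n E \<longrightarrow>
     (\<nexists>P. multipartite (\<lambda>u v. {u, v} \<in> E) {..<n} (Suc r) t P) \<longrightarrow>
     (1 - 1 / real r - \<delta>) * real n powr (2 - 2 / p) \<le> p_spectral_radius n E p \<longrightarrow>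
     (1 - 1 / real r - \<delta>') * (real n)\<^sup>2 \<le> real (card {(u, v) \<in> {..<n} \<times> {..<n}. {u, v} \<in> E})"
proof -
  \<comment> \<open>Three losses of at most \<open>\<rho> * n^2\<close> arise: slack in the
    hypothesis, excess in Erdos--Stone, and large entries. With one to spare, they cost
    \<open>4 * \<rho> * n^2\<close>, paid by the factor \<open>1 - 1/p\<close> in front of the edge
    count.\<close>
  define \<rho> where "\<rho> = (1 - 1 / p) * \<delta>' / 4"
  have p1: "0 < 1 - 1 / p" using p by simp
  have \<rho>: "\<rho> > 0" using p1 \<delta>' by (simp add: \<rho>_def)
  obtain \<eta> where \<eta>: "\<eta> > 0" and es: "\<And>A (S :: nat set) w. symp A \<Longrightarrow> irreflp A \<Longrightarrow> finite S \<Longrightarrow>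
     (\<forall>v\<in>S. 0 < w v \<and> w v \<le> \<eta>) \<Longrightarrow> sum w S \<le> 1 \<Longrightarrow>
     (1 - 1 / real r) * (sum w S)\<^sup>2 + \<rho> \<le> edge_weight w A S \<Longrightarrow> (\<exists>P. multipartite A S (Suc r) t P)"
    using erdos_stone_weighted[OF \<rho> r, of t, where 'a=nat] by blast
  \<comment> \<open>Chosen so that \<open>b u \<le> (\<rho> / 2) * b u powr p\<close> whenever
    \<open>b u > K\<close>; this is where \<open>p > 1\<close> makes large entries
    negligible.\<close>
  define K where "K = (2 / \<rho>) powr (1 / (p - 1))"
  have K0: "K > 0" using \<rho> by (simp add: K_def)
  have K: "K powr (1 - p) = \<rho> / 2"
  proof -
    have "1 / (p - 1) * (1 - p) = -1" using p by (simp add: field_simps)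
    then have "K powr (1 - p) = (2 / \<rho>) powr (-1)" by (simp only: K_def powr_powr)
    then show ?thesis using \<rho> by (simp add: powr_minus_divide)
  qed
  \<comment> \<open>Then \<open>K powr p / n \<le> \<eta>\<close>, the weight bound needed on
    \<open>S\<close>; the added 1 keeps \<open>n\<close> positive.\<close>
  define n0 where "n0 = nat \<lceil>K powr p / \<eta>\<rceil> + 1"
  show ?thesis
  proof (intro exI[of _ "\<rho> / 2"] conjI exI[of _ n0] allI impI)
    show "\<rho> / 2 > 0" using \<rho> by simp
    fix n E
    assume n: "n \<ge> n0" and G: "simple_graph n E"
      and no: "\<nexists>P. multipartite (\<lambda>u v. {u, v} \<in> E) {..<n} (Suc r) t P"
      and lam: "(1 - 1 / real r - \<rho> / 2) * real n powr (2 - 2 / p) \<le> p_spectral_radius n E p"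
    let ?V = "{..<n}"
    let ?D = "{(u, v) \<in> ?V \<times> ?V. {u, v} \<in> E}"
    let ?A = "\<lambda>u v. {u, v} \<in> E"
    have n1: "n > 0" using n by (simp add: n0_def)
    have "K powr p / \<eta> \<le> real (nat \<lceil>K powr p / \<eta>\<rceil>)" by (rule real_nat_ceiling_ge)
    also have "nat \<lceil>K powr p / \<eta>\<rceil> \<le> n" using n unfolding n0_def by linarith
    finally have nK: "K powr p \<le> \<eta> * real n" using \<eta> by (simp add: field_simps)
    \<comment> \<open>Passing from \<open>\<rho> / 2\<close> to \<open>\<rho>\<close> gives the
      strict inequality that a witness below the supremum requires.\<close>
    have "(1 - 1 / real r - \<rho>) * real n powr (2 - 2 / p) < (1 - 1 / real r - \<rho> / 2) * real n powr (2 - 2 / p)"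
      using \<rho> n1 by (intro mult_strict_right_mono) auto
    then have lam': "(1 - 1 / real r - \<rho>) * real n powr (2 - 2 / p) < p_spectral_radius n E p"
      using lam by linarith
    obtain b :: "nat \<Rightarrow> real" where b0: "\<And>u. 0 \<le> b u" and bp: "(\<Sum>u<n. b u powr p) = real n"
      and big: "(1 - 1 / real r - \<rho>) * (real n)\<^sup>2 < (\<Sum>(u, v)\<in>?D. b u * b v)"
      using normalized_spectral_witness[OF G n1 p lam'] by blast
    \<comment> \<open>Zero entries are left out because the weighted theorem wants positive weights;
      they contribute nothing to the form.\<close>
    define S where "S = {u\<in>?V. 0 < b u \<and> b u \<le> K}"
    define B where "B = {u\<in>?V. K < b u}"
    have fin: "finite S" "finite B" "S \<subseteq> ?V" "B \<subseteq> ?V" by (auto simp: S_def B_def)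
    have finD: "finite ?D" by (rule finite_subset[of _ "?V \<times> ?V"]) auto
    have sumb: "(\<Sum>u<n. b u) \<le> real n"
    proof -
      have "(\<Sum>u<n. b u) \<le> (\<Sum>u<n. b u powr p / p + (1 - 1 / p))"
        by (intro sum_mono le_powr_affine p b0)
      also have "\<dots> = real n / p + real n * (1 - 1 / p)"
        unfolding sum.distrib sum_divide_distrib[symmetric] bp by simp
      also have "\<dots> = real n" by (simp add: right_diff_distrib)
      finally show ?thesis .
    qed
    have sumB: "sum b B \<le> \<rho> / 2 * real n"
    proof -
      have "sum b B \<le> (\<Sum>u\<in>B. b u powr p * (\<rho> / 2))"
      proof (rule sum_mono)
        fix u assume "u \<in> B"
        then have u: "K < b u" by (simp add: B_def)
        have "b u = b u powr p * b u powr (1 - p)"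
          using u K0 by (simp add: powr_add[symmetric])
        also have "\<dots> \<le> b u powr p * K powr (1 - p)"
          using u K0 p by (intro mult_left_mono powr_mono2') auto
        finally show "b u \<le> b u powr p * (\<rho> / 2)" unfolding K .
      qed
      also have "\<dots> = (\<Sum>u\<in>B. b u powr p) * (\<rho> / 2)" by (simp add: sum_distrib_right)
      also have "\<dots> \<le> (\<Sum>u<n. b u powr p) * (\<rho> / 2)"
        using fin \<rho> by (intro mult_right_mono sum_mono2) auto
      finally show ?thesis by (simp add: bp mult_ac)
    qed
    define w where "w u = b u powr p / real n" for u
    have "(\<Sum>u\<in>S. w u) \<le> (\<Sum>u<n. w u)" using fin by (intro sum_mono2) (auto simp: w_def)
    also have "\<dots> = 1" using bp n1 by (simp add: w_def sum_divide_distrib[symmetric])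
    finally have wS: "sum w S \<le> 1" .
    have w0: "\<forall>v\<in>S. 0 < w v \<and> w v \<le> \<eta>"
    proof
      fix v assume "v \<in> S"
      then have v: "0 < b v" "b v \<le> K" by (auto simp: S_def)
      have "b v powr p \<le> K powr p" using v p by (intro powr_mono2) auto
      then show "0 < w v \<and> w v \<le> \<eta>" using nK n1 v by (simp add: w_def divide_le_eq)
    qed
    have "\<not> (1 - 1 / real r) * (sum w S)\<^sup>2 + \<rho> \<le> edge_weight w ?A S"
      using es[OF simple_graph_adjacency[OF G] fin(1) w0 wS] no fin(3) multipartite_mono by blast
    then have "edge_weight w ?A S < (1 - 1 / real r) * (sum w S)\<^sup>2 + \<rho>" by simp
    moreover have "(1 - 1 / real r) * (sum w S)\<^sup>2 \<le> (1 - 1 / real r) * 1"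
    proof (rule mult_left_mono)
      have "0 \<le> sum w S" using w0 by (intro sum_nonneg) (auto simp: less_imp_le)
      then show "(sum w S)\<^sup>2 \<le> 1" using wS by (simp add: power_le_one)
    qed (use r in simp)
    ultimately have ew: "edge_weight w ?A S \<le> 1 - 1 / real r + \<rho>" by simp
    let ?DS = "{(u, v) \<in> S \<times> S. {u, v} \<in> E}"
    have DS: "?DS \<subseteq> ?D" "finite ?DS"
    proof -
      show "?DS \<subseteq> ?D" using fin(3) by auto
      then show "finite ?DS" using finD by (rule finite_subset)
    qed
    have ewD: "(\<Sum>(u, v)\<in>?DS. (b u * b v) powr p) = (real n)\<^sup>2 * edge_weight w ?A S"
    proof -
      have "edge_weight w ?A S = (\<Sum>u\<in>S. \<Sum>v\<in>{v\<in>S. {u, v} \<in> E}. w u * w v)"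
        by (simp add: edge_weight_def deg_def sum_distrib_left)
      also have "\<dots> = (\<Sum>(u, v)\<in>(SIGMA u:S. {v\<in>S. {u, v} \<in> E}). w u * w v)"
        by (rule sum.Sigma) (use fin in auto)
      also have "(SIGMA u:S. {v\<in>S. {u, v} \<in> E}) = ?DS" by auto
      finally have "(real n)\<^sup>2 * edge_weight w ?A S = (\<Sum>(u, v)\<in>?DS. (real n)\<^sup>2 * (w u * w v))"
        by (simp add: sum_distrib_left case_prod_unfold)
      also have "\<dots> = (\<Sum>(u, v)\<in>?DS. (b u * b v) powr p)"
        using n1 b0 by (intro sum.cong) (auto simp: w_def powr_mult power2_eq_square)
      finally show ?thesis by simp
    qed
    have "(\<Sum>(u, v)\<in>?D. b u * b v) \<le> (\<Sum>(u, v)\<in>?DS. b u * b v) + ((\<Sum>(u, v)\<in>B \<times> ?V. b u * b v) + (\<Sum>(u, v)\<in>?V \<times> B. b u * b v))"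
    proof -
      have nn: "\<And>d. 0 \<le> (case d of (u, v) \<Rightarrow> b u * b v)" using b0 by (auto split: prod.split)
      have fB: "finite (B \<times> ?V)" "finite (?V \<times> B)" using fin by auto
      have "(\<Sum>(u, v)\<in>?D. b u * b v) = (\<Sum>(u, v)\<in>?D \<inter> (?DS \<union> (B \<times> ?V \<union> ?V \<times> B)). b u * b v)"
      proof (rule sum.mono_neutral_right[OF finD])
        show "\<forall>d\<in>?D - ?D \<inter> (?DS \<union> (B \<times> ?V \<union> ?V \<times> B)). (case d of (u, v) \<Rightarrow> b u * b v) = 0"
        proof
          fix d assume d: "d \<in> ?D - ?D \<inter> (?DS \<union> (B \<times> ?V \<union> ?V \<times> B))"
          obtain u v where uv: "d = (u, v)" by (cases d)
          have "u < n" "v < n" "{u, v} \<in> E" "u \<notin> B" "v \<notin> B" "\<not> (u \<in> S \<and> v \<in> S)" using d uv by auto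
          then have "b u = 0 \<or> b v = 0" using b0[of u] b0[of v] by (force simp: S_def B_def)
          then show "(case d of (u, v) \<Rightarrow> b u * b v) = 0" using uv by auto
        qed
      qed auto
      also have "\<dots> \<le> (\<Sum>(u, v)\<in>?DS \<union> (B \<times> ?V \<union> ?V \<times> B). b u * b v)"
        using nn DS fB by (intro sum_mono2) auto
      also have "\<dots> \<le> (\<Sum>(u, v)\<in>?DS. b u * b v) + (\<Sum>(u, v)\<in>B \<times> ?V \<union> ?V \<times> B. b u * b v)"
        using sum.union_inter[of ?DS "B \<times> ?V \<union> ?V \<times> B" "\<lambda>(u, v). b u * b v"] DS(2) fB
          sum_nonneg[of "?DS \<inter> (B \<times> ?V \<union> ?V \<times> B)" "\<lambda>(u, v). b u * b v"] nn by fastforce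
      also have "(\<Sum>(u, v)\<in>B \<times> ?V \<union> ?V \<times> B. b u * b v) \<le> (\<Sum>(u, v)\<in>B \<times> ?V. b u * b v) + (\<Sum>(u, v)\<in>?V \<times> B. b u * b v)"
        using sum.union_inter[of "B \<times> ?V" "?V \<times> B" "\<lambda>(u, v). b u * b v"] fB
          sum_nonneg[of "B \<times> ?V \<inter> ?V \<times> B" "\<lambda>(u, v). b u * b v"] nn by fastforce
      finally show ?thesis by simp
    qed
    also have "(\<Sum>(u, v)\<in>B \<times> ?V. b u * b v) = sum b B * (\<Sum>u<n. b u)"
      by (simp add: sum_product sum.cartesian_product)
    also have "(\<Sum>(u, v)\<in>?V \<times> B. b u * b v) = sum b B * (\<Sum>u<n. b u)"
      by (subst mult.commute) (simp add: sum_product sum.cartesian_product)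
    also have "sum b B * (\<Sum>u<n. b u) \<le> (\<rho> / 2 * real n) * real n"
      using sumB sumb \<rho> b0 by (intro mult_mono) (auto intro: sum_nonneg)
    \<comment> \<open>Here the edge count enters: the affine bound splits the form into a part with
      \<open>p\<close>-th powers, capped by Erdos--Stone, and a constant per pair.\<close>
    also have "(\<Sum>(u, v)\<in>?DS. b u * b v) \<le> (\<Sum>(u, v)\<in>?DS. (b u * b v) powr p / p + (1 - 1 / p))"
      using b0 by (intro sum_mono) (auto intro!: le_powr_affine p)
    also have "\<dots> = (\<Sum>(u, v)\<in>?DS. (b u * b v) powr p) / p + (1 - 1 / p) * real (card ?DS)"
      by (simp add: case_prod_unfold sum.distrib sum_divide_distrib mult.commute)
    also have "\<dots> \<le> (real n)\<^sup>2 * (1 - 1 / real r + \<rho>) / p + (1 - 1 / p) * real (card ?D)"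
      unfolding ewD using ew p p1 DS finD
      by (intro add_mono divide_right_mono mult_left_mono of_nat_mono card_mono) auto
    finally have main: "(\<Sum>(u, v)\<in>?D. b u * b v) \<le> (real n)\<^sup>2 * (1 - 1 / real r + \<rho>) / p
      + (1 - 1 / p) * real (card ?D) + \<rho> * (real n)\<^sup>2"
      by (simp add: power2_eq_square algebra_simps)
    have "(real n)\<^sup>2 * (1 - 1 / real r + \<rho>) / p = (real n)\<^sup>2 * (1 - 1 / real r) / p + \<rho> * (real n)\<^sup>2 / p"
      by (simp add: algebra_simps add_divide_distrib diff_divide_distrib)
    also have "\<rho> * (real n)\<^sup>2 / p \<le> \<rho> * (real n)\<^sup>2" 
      using \<rho> p mult_left_mono[of 1 p "\<rho> * (real n)\<^sup>2"] by (simp add: divide_le_eq)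
    finally have "(1 - 1 / real r) * (real n)\<^sup>2 - \<rho> * (real n)\<^sup>2
        < (real n)\<^sup>2 * (1 - 1 / real r) / p + (1 - 1 / p) * real (card ?D) + 2 * (\<rho> * (real n)\<^sup>2)"
      using big main by (simp add: algebra_simps)
    moreover have "(1 - 1 / p) * ((1 - 1 / real r) * (real n)\<^sup>2)
        = (1 - 1 / real r) * (real n)\<^sup>2 - (real n)\<^sup>2 * (1 - 1 / real r) / p"
      by (simp add: algebra_simps diff_divide_distrib)
    moreover have "0 \<le> \<rho> * (real n)\<^sup>2" using \<rho> by simp
    ultimately have "(1 - 1 / p) * ((1 - 1 / real r) * (real n)\<^sup>2) - 4 * (\<rho> * (real n)\<^sup>2) \<le> (1 - 1 / p) * real (card ?D)"
      by linarith
    moreover have "4 * (\<rho> * (real n)\<^sup>2) = (1 - 1 / p) * (\<delta>' * (real n)\<^sup>2)" by (simp add: \<rho>_def)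
    ultimately have "(1 - 1 / p) * ((1 - 1 / real r - \<delta>') * (real n)\<^sup>2) \<le> (1 - 1 / p) * real (card ?D)"
      by (simp add: left_diff_distrib right_diff_distrib)
    then show "(1 - 1 / real r - \<delta>') * (real n)\<^sup>2 \<le> real (card ?D)"
      using p1 by (rule mult_left_le_imp_le)
  qed
qed

section \<open>Choice of the constants and combination of the stages\<close>

theorem theorem3p11:
  fixes m r :: nat and EF :: "nat set set"
  assumes "simple_graph m EF"
    and "chromatic_number m EF = r + 1"
    and "r \<ge> 2"
  shows "\<forall>p::real. p > 1 \<longrightarrow> (\<forall>\<epsilon>::real. \<epsilon> > 0 \<longrightarrow>
           (\<exists>\<delta>::real. \<delta> > 0 \<and> (\<exists>n0::nat. \<forall>n::nat. \<forall>EG :: nat set set.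
              simple_graph n EG \<and> n \<ge> n0 \<and> \<not> contains_subgraph n EG m EF \<and>
              p_spectral_radius n EG p \<ge> (1 - 1 / real r - \<delta>) * real n powr (2 - 2 / p)
              \<longrightarrow> real (edit_distance n EG (turan_graph n r)) \<le> \<epsilon> * (real n)^2)))"
proof (intro allI impI)
  fix p \<epsilon> :: real
  assume p: "p > 1" and \<epsilon>: "\<epsilon> > 0"
  \<comment> \<open>\<open>\<theta>\<close> bounds the relative class imbalance: misplaced vertices
    then cost about \<open>r * \<theta> * n^2\<close>, a quarter of the budget.\<close>
  define \<theta> where "\<theta> = min 1 (\<epsilon> / (4 * real r))"
  have r: "r \<ge> 1" using assms(3) by simp
  have \<theta>: "0 < \<theta>" "\<theta> \<le> 1" "real r * \<theta> \<le> \<epsilon> / 4"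
  proof -
    show "0 < \<theta>" "\<theta> \<le> 1" using \<epsilon> r by (auto simp: \<theta>_def)
    have "real r * \<theta> \<le> real r * (\<epsilon> / (4 * real r))" by (intro mult_left_mono) (auto simp: \<theta>_def)
    then show "real r * \<theta> \<le> \<epsilon> / 4" using r by simp
  qed
  define \<kappa> where "\<kappa> = \<theta>\<^sup>2 / 2"
  have \<kappa>: "\<kappa> > 0" using \<theta> by (simp add: \<kappa>_def)
  have "\<theta>\<^sup>2 \<le> real r * \<theta>"
    unfolding power2_eq_square using \<theta> r by (intro mult_right_mono) auto
  then have \<kappa>\<epsilon>: "3 * \<kappa> \<le> \<epsilon> / 2" using \<theta> \<epsilon> by (simp add: \<kappa>_def)
  obtain \<delta>1 n1 where \<delta>1: "\<delta>1 > 0" and part: "\<And>A (V :: nat set). symp A \<Longrightarrow> irreflp A \<Longrightarrow> finite V \<Longrightarrow>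
     n1 \<le> card V \<Longrightarrow> (\<nexists>P. multipartite A V (Suc r) m P) \<Longrightarrow>
     (1 - 1 / real r - \<delta>1) * (real (card V))\<^sup>2 \<le> real (card {(u, v) \<in> V \<times> V. A u v}) \<Longrightarrow>
     (\<exists>c. (\<forall>v. c v < r) \<and> real (card {(u, v) \<in> V \<times> V. A u v \<and> c u = c v}) \<le> \<kappa> * (real (card V))\<^sup>2)"
    using stability_partition[OF \<kappa> assms(3), of m, where 'a=nat] by blast
  \<comment> \<open>Small enough for the partition and, as \<open>\<kappa> = \<theta>^2 / 2\<close>,
    for \<open>\<delta>2 + \<kappa> \<le> \<theta>^2\<close>.\<close>
  define \<delta>2 where "\<delta>2 = min \<delta>1 \<kappa>"
  have \<delta>2: "\<delta>2 > 0" using \<delta>1 \<kappa> by (simp add: \<delta>2_def)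
  obtain \<delta> n2 where \<delta>: "\<delta> > 0" and dense: "\<And>n E. n \<ge> n2 \<Longrightarrow> simple_graph n E \<Longrightarrow>
     (\<nexists>P. multipartite (\<lambda>u v. {u, v} \<in> E) {..<n} (Suc r) m P) \<Longrightarrow>
     (1 - 1 / real r - \<delta>) * real n powr (2 - 2 / p) \<le> p_spectral_radius n E p \<Longrightarrow>
     (1 - 1 / real r - \<delta>2) * (real n)\<^sup>2 \<le> real (card {(u, v) \<in> {..<n} \<times> {..<n}. {u, v} \<in> E})"
    using spectral_imp_dense[OF p r \<delta>2, of m] by blast
  \<comment> \<open>Absorbs the linear term \<open>r * n\<close>, which stems from rounding in the
    part sizes of the Turan graph.\<close>
  define n3 where "n3 = nat \<lceil>4 * real r / \<epsilon>\<rceil>"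
  show "\<exists>\<delta>::real. \<delta> > 0 \<and> (\<exists>n0::nat. \<forall>n::nat. \<forall>EG :: nat set set.
              simple_graph n EG \<and> n \<ge> n0 \<and> \<not> contains_subgraph n EG m EF \<and>
              p_spectral_radius n EG p \<ge> (1 - 1 / real r - \<delta>) * real n powr (2 - 2 / p)
              \<longrightarrow> real (edit_distance n EG (turan_graph n r)) \<le> \<epsilon> * (real n)^2)"
  proof (intro exI[of _ \<delta>] conjI exI[of _ "n1 + n2 + n3"] allI impI, rule \<delta>)
    fix n EG
    assume "simple_graph n EG \<and> n1 + n2 + n3 \<le> n \<and> \<not> contains_subgraph n EG m EF \<and>
              p_spectral_radius n EG p \<ge> (1 - 1 / real r - \<delta>) * real n powr (2 - 2 / p)"
    then have G: "simple_graph n EG" and n: "n1 \<le> n" "n2 \<le> n" "n3 \<le> n"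
      and noF: "\<not> contains_subgraph n EG m EF"
      and lam: "(1 - 1 / real r - \<delta>) * real n powr (2 - 2 / p) \<le> p_spectral_radius n EG p" by auto
    have no: "\<nexists>P. multipartite (\<lambda>u v. {u, v} \<in> EG) {..<n} (Suc r) m P"
      using contains_subgraph_of_multipartite[OF assms(1) G] noF
        colorable_chromatic_number[OF assms(1)] assms(2) by fastforce
    have e2: "(1 - 1 / real r - \<delta>2) * (real n)\<^sup>2 \<le> real (card {(u, v) \<in> {..<n} \<times> {..<n}. {u, v} \<in> EG})"
      by (rule dense[OF n(2) G no lam])
    moreover have "(1 - 1 / real r - \<delta>1) * (real n)\<^sup>2 \<le> (1 - 1 / real r - \<delta>2) * (real n)\<^sup>2"
      by (intro mult_right_mono) (auto simp: \<delta>2_def)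
    ultimately have e1: "(1 - 1 / real r - \<delta>1) * (real n)\<^sup>2 \<le> real (card {(u, v) \<in> {..<n} \<times> {..<n}. {u, v} \<in> EG})"
      by linarith
    obtain c where c: "\<And>v. c v < r"
      "real (card {(u, v) \<in> {..<n} \<times> {..<n}. {u, v} \<in> EG \<and> c u = c v}) \<le> \<kappa> * (real n)\<^sup>2"
      using part[OF simple_graph_adjacency[OF G], of "{..<n}"] n(1) no e1 by auto
    have "real (edit_distance n EG (turan_graph n r))
        \<le> real r * (\<theta> * real n + 1) * real n + (\<delta>2 + 2 * \<kappa>) * (real n)\<^sup>2"
      by (rule edit_distance_turan_le[OF G r c(1) e2 c(2)]) (use \<theta> in \<open>auto simp: \<delta>2_def \<kappa>_def\<close>)
    also have "\<dots> = real r * \<theta> * (real n)\<^sup>2 + real r * real n + (\<delta>2 + 2 * \<kappa>) * (real n)\<^sup>2"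
      by (simp add: power2_eq_square algebra_simps)
    also have "\<dots> \<le> \<epsilon> / 4 * (real n)\<^sup>2 + \<epsilon> / 4 * (real n)\<^sup>2 + \<epsilon> / 2 * (real n)\<^sup>2"
    proof (intro add_mono mult_right_mono)
      show "real r * \<theta> \<le> \<epsilon> / 4" by (rule \<theta>(3))
      show "\<delta>2 + 2 * \<kappa> \<le> \<epsilon> / 2" using \<kappa>\<epsilon> by (simp add: \<delta>2_def)
      have "4 * real r / \<epsilon> \<le> real n3" unfolding n3_def by (rule real_nat_ceiling_ge)
      also have "\<dots> \<le> real n" using n by simp
      finally have "real r \<le> \<epsilon> / 4 * real n" using \<epsilon> by (simp add: field_simps)
      then have "real r * real n \<le> \<epsilon> / 4 * real n * real n" by (rule mult_right_mono) simp
      then show "real r * real n \<le> \<epsilon> / 4 * (real n)\<^sup>2" by (simp add: power2_eq_square)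
    qed auto
    finally show "real (edit_distance n EG (turan_graph n r)) \<le> \<epsilon> * (real n)\<^sup>2" by simp
  qed
qed

end
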